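(* Let $\mathscr{A}$ be a $C^*$-algebra, $\mathscr{E}$ a Hilbert $C^*$-module over $\mathscr{A}$, $S$ a non-empty set, and let $K,K':S\times S\to\mathcal{L}(\mathscr{E})$ be conditionally positive definite kernels. Suppose there is $s_0\in S$ such that $K(s,s_0)$ and $K'(s,s_0)$ are self-adjoint for all $s\in S$, and suppose that $K(s,s)=K'(s,s)=0$ for all $s\in S$. Suppose that $K$ and $K'$ are regular (with respect to the base point $s_0$), and let $(V,\mathscr{F})$ be the minimal Kolmogorov decomposition of $K$ (with base point $s_0$). Then $K'\leq K$ if and only if there exists a positive contraction $C\in \mathcal{L}(\mathscr{F})$ such that $$K'(s,t)= 2V(s)^*C^*CV(t)-V(s)^*C^*CV(s)-V(t)^*C^*CV(t)$$ for all $s, t\in S$.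
   Context: $\mathcal{L}(\mathscr{E},\mathscr{F})$ denotes the set of adjointable maps between Hilbert $C^*$-modules over $\mathscr{A}$, and $\mathcal{L}(\mathscr{E}):=\mathcal{L}(\mathscr{E},\mathscr{E})$, a unital $C^*$-algebra. For a $C^*$-algebra $\mathscr{B}$, a kernel $K:S\times S\to\mathscr{B}$ is hermitian if $K(t,s)^*=K(s,t)$ for all $s,t$; a hermitian kernel is conditionally positive definite if $\sum_{i,j=1}^n b_i^*K(s_i,s_j)b_j\geq 0$ for all $n\geq 2$, $s_1,\dots,s_n\in S$ and $b_1,\dots,b_n\in\mathscr{B}$ with $\sum_{i=1}^n b_i=0$. Here $\mathscr{B}=\mathcal{L}(\mathscr{E})$. For conditionally positive definite kernels $K,K'$, one writes $K'\leq K$ when $K-K'$ is conditionally positive definite. Minimal Kolmogorov decomposition (with base point $s_0\in S$) of a conditionally positive definite kernel $K:S\times S\to\mathcal{L}(\mathscr{E})$: put $L(s,t)=\frac12\left(K(s,t)-K(s,s_0)-K(s_0,t)+K(s_0,s_0)\right)$. For each finitely supported map $f:S\to\mathscr{E}$ let $\widehat{L}f:S\to\mathscr{E}$, $\widehat{L}f(s)=\sum_{t\in S}L(s,t)f(t)$. Let $\mathscr{F}_0$ be the $\mathscr{A}$-module of all such maps $\widehat{L}f$ with pointwise operations and the $\mathscr{A}$-valued inner product $\langle \widehat{L}f,\widehat{L}g\rangle=\sum_{s,t\in S}\langle L(s,t)f(t),g(s)\rangle$, and let $\mathscr{F}$ be its completion, a Hilbert $\mathscr{A}$-module. Define $V:S\to\mathcal{L}(\mathscr{E},\mathscr{F})$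 by $V(s)x=\widehat{L}(x_s)$, where $x_s(s)=x$ and $x_s(t)=0$ for $t\neq s$. Then $V(s)^*V(t)=L(s,t)$. With $h(s)=-\frac12K(s,s)-\mathrm{i}\,\mathrm{Im}\,K(s,s_0)$ one has $K(s,t)=2V(s)^*V(t)-V(s)^*V(s)-V(t)^*V(t)-h(s)-h(t)^*$. The triple $(V,\mathscr{F},h)$, or the pair $(V,\mathscr{F})$ when $h=0$, is called the minimal Kolmogorov decomposition of $K$. A Hilbert $C^*$-module $\mathscr{F}$ over $\mathscr{A}$ is self-dual if for every bounded $\mathscr{A}$-linear map $\varphi:\mathscr{F}\to\mathscr{A}$ there is $x_0\in\mathscr{F}$ with $\varphi(x)=\langle x_0,x\rangle$ for all $x\in\mathscr{F}$. The kernel $K$ is regular if the Hilbert $C^*$-module $\mathscr{F}$ of its minimal Kolmogorov decomposition is self-dual. Inner products are $\mathscr{A}$-linear in the second variable. A contraction is an operator of norm at most $1$, and positive means positive in the $C^*$-algebra $\mathcal{L}(\mathscr{F})$. *)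

theory Defs
  imports "HOL-Analysis.Analysis"
begin

class complex_vector = real_vector +
  fixes scaleC :: "complex \<Rightarrow> 'a \<Rightarrow> 'a"
  assumes scaleC_add_right: "scaleC c (x + y) = scaleC c x + scaleC c y"
    and scaleC_add_left: "scaleC (c + d) x = scaleC c x + scaleC d x"
    and scaleC_scaleC: "scaleC c (scaleC d x) = scaleC (c * d) x"
    and scaleC_one: "scaleC 1 x = x"
    and scaleR_scaleC: "scaleR r x = scaleC (complex_of_real r) x"

text \<open>C*-algebras, not assumed to be unital or nonzero.\<close>

class cstar_algebra = complex_vector + real_normed_algebra + banach +
  fixes star :: "'a \<Rightarrow> 'a"
  assumes norm_scaleC: "norm (scaleC c x) = cmod c * norm x"
    and mult_scaleC_left: "scaleC c x * y = scaleC c (x * y)"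
    and mult_scaleC_right: "x * scaleC c y = scaleC c (x * y)"
    and star_add: "star (x + y) = star x + star y"
    and star_scaleC: "star (scaleC c x) = scaleC (cnj c) (star x)"
    and star_mult: "star (x * y) = star y * star x"
    and star_star: "star (star x) = x"
    and cstar_identity: "norm (star x * x) = (norm x)\<^sup>2"

definition cstar_positive :: "'a::cstar_algebra \<Rightarrow> bool" where
  "cstar_positive a \<longleftrightarrow> (\<exists>b. a = star b * b)"

definition hm_norm :: "('e \<Rightarrow> 'e \<Rightarrow> 'a::cstar_algebra) \<Rightarrow> 'e \<Rightarrow> real" where
  "hm_norm ip x = sqrt (norm (ip x x))"

text \<open>Right Hilbert modules; the inner product is linear in the second variable.\<close>

locale hilbert_module =
  fixes act :: "'e::complex_vector \<Rightarrow> 'a::cstar_algebra \<Rightarrow> 'e"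
    and ip :: "'e \<Rightarrow> 'e \<Rightarrow> 'a"
  assumes act_add_left: "act (x + y) a = act x a + act y a"
    and act_add_right: "act x (a + b) = act x a + act x b"
    and act_mult: "act x (a * b) = act (act x a) b"
    and act_scaleC_left: "act (scaleC c x) a = scaleC c (act x a)"
    and act_scaleC_right: "act x (scaleC c a) = scaleC c (act x a)"
    and ip_add_right: "ip x (y + z) = ip x y + ip x z"
    and ip_scaleC_right: "ip x (scaleC c y) = scaleC c (ip x y)"
    and ip_act_right: "ip x (act y a) = ip x y * a"
    and ip_star: "star (ip x y) = ip y x"
    and ip_positive: "cstar_positive (ip x x)"
    and ip_definite: "ip x x = 0 \<Longrightarrow> x = 0"
    and complete:
      "(\<And>e. e > 0 \<Longrightarrow> \<exists>N. \<forall>m\<ge>N. \<forall>n\<ge>N. hm_norm ip (X m - X n) < e) \<Longrightarrow>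
        \<exists>l. (\<lambda>n. hm_norm ip (X n - l)) \<longlonglongrightarrow> 0"

definition hm_is_adjoint ::
  "('e \<Rightarrow> 'e \<Rightarrow> 'a) \<Rightarrow> ('f \<Rightarrow> 'f \<Rightarrow> 'a) \<Rightarrow> ('e \<Rightarrow> 'f) \<Rightarrow> ('f \<Rightarrow> 'e) \<Rightarrow> bool" where
  "hm_is_adjoint ipE ipF T T' \<longleftrightarrow> (\<forall>x y. ipF (T x) y = ipE x (T' y))"

text \<open>As usual, adjointable maps need not be assumed linear or bounded.\<close>

definition adjointables ::
  "('e \<Rightarrow> 'e \<Rightarrow> 'a) \<Rightarrow> ('f \<Rightarrow> 'f \<Rightarrow> 'a) \<Rightarrow> ('e \<Rightarrow> 'f) set" where
  "adjointables ipE ipF = {T. \<exists>T'. hm_is_adjoint ipE ipF T T'}"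

text \<open>The adjoint is unique for Hilbert modules; it is meaningful only for adjointable maps.\<close>

definition hm_adjoint ::
  "('e \<Rightarrow> 'e \<Rightarrow> 'a) \<Rightarrow> ('f \<Rightarrow> 'f \<Rightarrow> 'a) \<Rightarrow> ('e \<Rightarrow> 'f) \<Rightarrow> 'f \<Rightarrow> 'e" where
  "hm_adjoint ipE ipF T = (SOME T'. hm_is_adjoint ipE ipF T T')"

definition self_adjoint_op :: "('e \<Rightarrow> 'e \<Rightarrow> 'a) \<Rightarrow> ('e \<Rightarrow> 'e) \<Rightarrow> bool" where
  "self_adjoint_op ip T \<longleftrightarrow> T \<in> adjointables ip ip \<and> hm_adjoint ip ip T = T"

text \<open>Positivity in the C*-algebra of adjointable operators.\<close>

definition positive_op :: "('e \<Rightarrow> 'e \<Rightarrow> 'a) \<Rightarrow> ('e \<Rightarrow> 'e) \<Rightarrow> bool" where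
  "positive_op ip T \<longleftrightarrow> (\<exists>B \<in> adjointables ip ip. T = hm_adjoint ip ip B \<circ> B)"

text \<open>The operator norm is taken in the extended reals so that the supremum always makes sense.\<close>

definition hm_op_norm ::
  "('e \<Rightarrow> 'e \<Rightarrow> 'a::cstar_algebra) \<Rightarrow> ('f \<Rightarrow> 'f \<Rightarrow> 'a) \<Rightarrow> ('e \<Rightarrow> 'f) \<Rightarrow> ennreal" where
  "hm_op_norm ipE ipF T = (SUP x\<in>{x. hm_norm ipE x \<le> 1}. ennreal (hm_norm ipF (T x)))"

definition self_dual ::
  "('f::complex_vector \<Rightarrow> 'a::cstar_algebra \<Rightarrow> 'f) \<Rightarrow> ('f \<Rightarrow> 'f \<Rightarrow> 'a) \<Rightarrow> bool" where
  "self_dual act ip \<longleftrightarrow>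
    (\<forall>\<phi> :: 'f \<Rightarrow> 'a.
      (\<forall>x y. \<phi> (x + y) = \<phi> x + \<phi> y) \<and>
      (\<forall>c x. \<phi> (scaleC c x) = scaleC c (\<phi> x)) \<and>
      (\<forall>x a. \<phi> (act x a) = \<phi> x * a) \<and>
      (\<exists>M. \<forall>x. norm (\<phi> x) \<le> M * hm_norm ip x)
      \<longrightarrow> (\<exists>x0. \<forall>x. \<phi> x = ip x0 x))"

definition hermitian_kernel ::
  "('e \<Rightarrow> 'e \<Rightarrow> 'a) \<Rightarrow> ('s \<Rightarrow> 's \<Rightarrow> 'e \<Rightarrow> 'e) \<Rightarrow> bool" where
  "hermitian_kernel ip K \<longleftrightarrow>
    (\<forall>s t. K s t \<in> adjointables ip ip) \<and> (\<forall>s t. hm_adjoint ip ip (K t s) = K s t)"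

definition cond_pos_def_kernel ::
  "('e::complex_vector \<Rightarrow> 'e \<Rightarrow> 'a) \<Rightarrow> ('s \<Rightarrow> 's \<Rightarrow> 'e \<Rightarrow> 'e) \<Rightarrow> bool" where
  "cond_pos_def_kernel ip K \<longleftrightarrow>
    hermitian_kernel ip K \<and>
    (\<forall>(n::nat) (s :: nat \<Rightarrow> 's) (b :: nat \<Rightarrow> 'e \<Rightarrow> 'e).
      n \<ge> 2 \<and> (\<forall>i<n. b i \<in> adjointables ip ip) \<and> (\<forall>x. (\<Sum>i<n. b i x) = 0) \<longrightarrow>
      positive_op ip (\<lambda>x. \<Sum>i<n. \<Sum>j<n. hm_adjoint ip ip (b i) (K (s i) (s j) (b j x))))"

definition kernel_le ::
  "('e::complex_vector \<Rightarrow> 'e \<Rightarrow> 'a) \<Rightarrow> ('s \<Rightarrow> 's \<Rightarrow> 'e \<Rightarrow> 'e) \<Rightarrow> ('s \<Rightarrow> 's \<Rightarrow> 'e \<Rightarrow> 'e) \<Rightarrow> bool" where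
  "kernel_le ip K' K \<longleftrightarrow> cond_pos_def_kernel ip (\<lambda>s t x. K s t x - K' s t x)"

definition kolm_L ::
  "('s \<Rightarrow> 's \<Rightarrow> 'e::complex_vector \<Rightarrow> 'e) \<Rightarrow> 's \<Rightarrow> 's \<Rightarrow> 's \<Rightarrow> 'e \<Rightarrow> 'e" where
  "kolm_L K s0 s t x = (1/2) *\<^sub>R (K s t x - K s s0 x - K s0 t x + K s0 s0 x)"

definition kolm_hat ::
  "('s \<Rightarrow> 's \<Rightarrow> 'e::complex_vector \<Rightarrow> 'e) \<Rightarrow> ('s \<Rightarrow> 'e) \<Rightarrow> 's \<Rightarrow> 'e" where
  "kolm_hat L f s = (\<Sum>t | f t \<noteq> 0. L s t (f t))"

definition fin_supp :: "('s \<Rightarrow> 'e::zero) set" where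
  "fin_supp = {f. finite {t. f t \<noteq> 0}}"

definition point_map :: "'s \<Rightarrow> 'e::zero \<Rightarrow> 's \<Rightarrow> 'e" where
  "point_map s x = (\<lambda>t. if t = s then x else 0)"

text \<open>
  \<open>kolm_completion actE ipE L actF ipF \<iota>\<close>: the Hilbert module given by \<open>actF\<close> and \<open>ipF\<close>,
  together with the embedding \<open>\<iota>\<close>, is a completion of the module of all maps \<open>kolm_hat L f\<close>
  with \<open>f\<close> finitely supported.  The operations of the latter module are pointwise, and its inner
  product is defined through representatives \<open>f\<close>, \<open>g\<close>.  The map \<open>\<iota>\<close> matters only on that module.
\<close>

definition kolm_completion ::
  "('e::complex_vector \<Rightarrow> 'a::cstar_algebra \<Rightarrow> 'e) \<Rightarrow> ('e \<Rightarrow> 'e \<Rightarrow> 'a) \<Rightarrow>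
   ('s \<Rightarrow> 's \<Rightarrow> 'e \<Rightarrow> 'e) \<Rightarrow>
   ('f::complex_vector \<Rightarrow> 'a \<Rightarrow> 'f) \<Rightarrow> ('f \<Rightarrow> 'f \<Rightarrow> 'a) \<Rightarrow> (('s \<Rightarrow> 'e) \<Rightarrow> 'f) \<Rightarrow> bool" where
  "kolm_completion actE ipE L actF ipF \<iota> \<longleftrightarrow>
    (let F0 = kolm_hat L ` fin_supp in
      hilbert_module actF ipF \<and>
      (\<forall>u\<in>F0. \<forall>v\<in>F0. \<iota> (\<lambda>s. u s + v s) = \<iota> u + \<iota> v) \<and>
      (\<forall>c. \<forall>u\<in>F0. \<iota> (\<lambda>s. scaleC c (u s)) = scaleC c (\<iota> u)) \<and>
      (\<forall>a. \<forall>u\<in>F0. \<iota> (\<lambda>s. actE (u s) a) = actF (\<iota> u) a) \<and>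
      (\<forall>f\<in>fin_supp. \<forall>g\<in>fin_supp.
         ipF (\<iota> (kolm_hat L f)) (\<iota> (kolm_hat L g)) =
           (\<Sum>s | g s \<noteq> 0. \<Sum>t | f t \<noteq> 0. ipE (L s t (f t)) (g s))) \<and>
      (\<forall>y. \<forall>e>0. \<exists>u\<in>F0. hm_norm ipF (y - \<iota> u) < e))"

text \<open>
  The completion is determined only up to unitary isomorphism, so the decomposition is a
  predicate: it holds for \<open>V\<close> and \<open>F\<close> if \<open>F\<close> is some completion as above and \<open>V\<close> is the
  corresponding map.
\<close>

definition min_kolmogorov ::
  "('e::complex_vector \<Rightarrow> 'a::cstar_algebra \<Rightarrow> 'e) \<Rightarrow> ('e \<Rightarrow> 'e \<Rightarrow> 'a) \<Rightarrow>
   ('s \<Rightarrow> 's \<Rightarrow> 'e \<Rightarrow> 'e) \<Rightarrow> 's \<Rightarrow>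
   ('f::complex_vector \<Rightarrow> 'a \<Rightarrow> 'f) \<Rightarrow> ('f \<Rightarrow> 'f \<Rightarrow> 'a) \<Rightarrow> ('s \<Rightarrow> 'e \<Rightarrow> 'f) \<Rightarrow> bool" where
  "min_kolmogorov actE ipE K s0 actF ipF V \<longleftrightarrow>
    (\<exists>\<iota>. kolm_completion actE ipE (kolm_L K s0) actF ipF \<iota> \<and>
      (\<forall>s x. V s x = \<iota> (kolm_hat (kolm_L K s0) (point_map s x))))"

end

theory Submission
  imports Defs
begin

text \<open>
  Since \<open>L\<close> determines \<open>K\<close>, and the terms \<open>L(s,s)\<close> drop out for families with zero sum,
  \<open>K' \<le> K\<close> amounts to \<open>\<langle>W u, W u\<rangle> \<le> \<langle>u, u\<rangle>\<close> for the map \<open>W\<close> sending \<open>V(s)x\<close> to \<open>V'(s)x\<close>. So \<open>W\<close>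
  extends to a contraction of the completions, self-duality of the domain provides an adjoint, and
  \<open>C\<close> is the square root of \<open>W\<^sup>* W\<close>. Conversely, for operators \<open>b\<^sub>i\<close> with zero sum and
  \<open>X = \<Sum> V(s\<^sub>i) b\<^sub>i\<close>, the form of \<open>K - K'\<close> is \<open>2 X\<^sup>* (1 - C\<^sup>* C) X\<close>.

  The spectral theory that this needs is obtained from a single iteration for \<open>\<surd>(1 - S)\<close> with
  \<open>\<parallel>S\<parallel> \<le> 1\<close>: it yields square roots and negative parts that commute with whatever commutes with
  the given operator. Applied to the algebra as a module over itself, it shows that \<open>b\<^sup>* b\<close> has a
  norm-theoretic description by which positive elements form a cone with monotone norm; the
  Cauchy-Schwarz inequality for modules follows, and with it the same theory for operators on
  modules.
\<close>

section \<open>Symmetric operators and square roots\<close>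

text \<open>There is an apparent circle: the order of the algebra is defined through elements star b
  * b, module Cauchy-Schwarz needs that order, and the spectral arguments need Cauchy-Schwarz. It is
  broken by making the norm inequality an axiom of \<open>ip_space\<close>: for the algebra it is
  submultiplicativity of the norm, and for modules it is proved once the order is understood. As the
  algebra may lack a unit, an element is studied through its left multiplication, where the identity
  operator serves as 1.

  Negative parts are always disposed of alike. If N is the negative part of T, then T N = - N^2; a
  test on the range of N makes a power of N vanish, and a nilpotent symmetric operator is 0.

  Two gaps separate the definitions from the estimates. Adjointable maps are not assumed bounded, so
  bounds come from Baire category. Conditional positivity speaks of operator coefficients, while
  comparing norms in the completions requires vector coefficients. Finally, a contraction between
  Hilbert modules need not be adjointable, which is why self-duality enters.\<close>

lemma scaleC_zero_right [simp]: "scaleC c (0::'a::complex_vector) = 0"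
  using scaleC_add_right[of c 0 0] by simp

lemma scaleC_minus_right: "scaleC c (- x) = - scaleC c (x::'a::complex_vector)"
  using scaleC_add_right[of c x "- x"] by (simp add: eq_neg_iff_add_eq_0 add.commute)

lemma scaleC_diff_right: "scaleC c (x - y) = scaleC c x - scaleC c (y::'a::complex_vector)"
  using scaleC_add_right[of c x "- y"] by (simp add: scaleC_minus_right)

lemma scaleC_minus_one: "scaleC (- 1) (x::'a::complex_vector) = - x"
  using scaleR_scaleC[of "-1" x] by simp

lemma star_zero [simp]: "star (0::'a::cstar_algebra) = 0"
  using star_add[of "0::'a" 0] by simp

lemma star_scaleR: "star (r *\<^sub>R x) = r *\<^sub>R star (x::'a::cstar_algebra)"
  by (simp add: scaleR_scaleC star_scaleC)

lemma norm_star [simp]: "norm (star x) = norm (x::'a::cstar_algebra)"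
proof -
  have le: "norm y \<le> norm (star y)" for y :: 'a
  proof (cases "y = 0")
    case False
    have "norm y * norm y \<le> norm (star y) * norm y"
      using norm_mult_ineq[of "star y" y] by (simp add: cstar_identity power2_eq_square)
    then show ?thesis using False by simp
  qed auto
  from le[of x] le[of "star x"] show ?thesis by (simp add: star_star)
qed

text \<open>Hilbert modules as mere normed spaces with an algebra-valued form. Positivity of the form
  is left out, so that the spectral arguments apply to the algebra itself before positive elements
  are understood.\<close>

locale ip_space =
  fixes ip :: "'e::complex_vector \<Rightarrow> 'e \<Rightarrow> 'a::cstar_algebra"
  assumes ip_add_right: "ip x (y + z) = ip x y + ip x z"
    and ip_scaleC_right: "ip x (scaleC c y) = scaleC c (ip x y)"
    and ip_star: "star (ip x y) = ip y x"
    and ip_definite: "ip x x = 0 \<Longrightarrow> x = 0"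
    and ip_Cauchy_Schwarz: "norm (ip x y) \<le> hm_norm ip x * hm_norm ip y"
    and complete:
      "(\<And>e. e > 0 \<Longrightarrow> \<exists>N. \<forall>m\<ge>N. \<forall>n\<ge>N. hm_norm ip (X m - X n) < e) \<Longrightarrow>
        \<exists>l. (\<lambda>n. hm_norm ip (X n - l)) \<longlonglongrightarrow> 0"
begin

abbreviation nrm :: "'e \<Rightarrow> real" where "nrm \<equiv> hm_norm ip"

lemma ip_add_left: "ip (x + y) z = ip x z + ip y z"
  by (metis ip_add_right ip_star star_add)

lemma ip_scaleC_left: "ip (scaleC c x) y = scaleC (cnj c) (ip x y)"
  by (metis ip_scaleC_right ip_star star_scaleC)

lemma ip_scaleR_right: "ip x (r *\<^sub>R y) = r *\<^sub>R ip x y"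
  by (simp add: scaleR_scaleC ip_scaleC_right)

lemma ip_scaleR_left: "ip (r *\<^sub>R x) y = r *\<^sub>R ip x y"
  by (simp add: scaleR_scaleC ip_scaleC_left)

lemma ip_zero_right [simp]: "ip x 0 = 0"
  using ip_add_right[of x 0 0] by simp

lemma ip_zero_left [simp]: "ip 0 x = 0"
  using ip_add_left[of 0 0 x] by simp

lemma ip_minus_right: "ip x (- y) = - ip x y"
  using ip_scaleR_right[of x "-1" y] by simp

lemma ip_minus_left: "ip (- x) y = - ip x y"
  using ip_scaleR_left[of "-1" x y] by simp

lemma ip_diff_right: "ip x (y - z) = ip x y - ip x z"
  using ip_add_right[of x y "- z"] by (simp add: ip_minus_right)

lemma ip_diff_left: "ip (x - y) z = ip x z - ip y z"
  using ip_add_left[of x "- y" z] by (simp add: ip_minus_left)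

lemma ip_sum_right: "ip x (sum f I) = (\<Sum>i\<in>I. ip x (f i))"
  by (induction I rule: infinite_finite_induct) (auto simp: ip_add_right)

lemma ip_sum_left: "ip (sum f I) x = (\<Sum>i\<in>I. ip (f i) x)"
  by (induction I rule: infinite_finite_induct) (auto simp: ip_add_left)

lemmas ip_simps = ip_add_left ip_add_right ip_diff_left ip_diff_right ip_minus_left ip_minus_right
  ip_scaleR_left ip_scaleR_right

lemma ip_eqI: assumes "\<And>z. ip z x = ip z y" shows "x = y"
  using ip_definite[of "x - y"] assms[of "x - y"] by (simp add: ip_diff_right)

lemma nrm_ge_0 [simp]: "0 \<le> nrm x"
  by (simp add: hm_norm_def)

lemma nrm_power2: "(nrm x)\<^sup>2 = norm (ip x x)"
  by (simp add: hm_norm_def)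

lemma nrm_zero [simp]: "nrm 0 = 0"
  by (simp add: hm_norm_def)

lemma nrm_eq_0 [simp]: "nrm x = 0 \<longleftrightarrow> x = 0"
  by (auto simp: hm_norm_def dest: ip_definite)

lemma nrm_scaleC: "nrm (scaleC c x) = cmod c * nrm x"
  by (simp add: hm_norm_def ip_scaleC_left ip_scaleC_right norm_scaleC real_sqrt_mult)

lemma nrm_scaleR: "nrm (r *\<^sub>R x) = \<bar>r\<bar> * nrm x"
  by (simp add: scaleR_scaleC nrm_scaleC)

lemma nrm_minus [simp]: "nrm (- x) = nrm x"
  using nrm_scaleR[of "-1" x] by simp

lemma nrm_minus_commute: "nrm (x - y) = nrm (y - x)"
  using nrm_minus[of "x - y"] by simp

lemma nrm_triangle: "nrm (x + y) \<le> nrm x + nrm y"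
proof (rule power2_le_imp_le)
  have "(nrm (x + y))\<^sup>2 = norm (ip x x + ip x y + ip y x + ip y y)"
    by (simp add: nrm_power2 ip_simps algebra_simps)
  also have "\<dots> \<le> norm (ip x x) + norm (ip x y) + norm (ip y x) + norm (ip y y)"
    by (meson norm_triangle_le order_refl add_mono)
  also have "\<dots> \<le> (nrm x)\<^sup>2 + nrm x * nrm y + nrm y * nrm x + (nrm y)\<^sup>2"
    unfolding nrm_power2 by (intro add_mono ip_Cauchy_Schwarz order_refl)
  finally show "(nrm (x + y))\<^sup>2 \<le> (nrm x + nrm y)\<^sup>2"
    by (simp add: power2_eq_square algebra_simps)
qed simp

lemma nrm_triangle_diff: "nrm (x - y) \<le> nrm x + nrm y"
  using nrm_triangle[of x "- y"] by simp

lemma nrm_triangle_mid: "nrm (x - z) \<le> nrm (x - y) + nrm (y - z)"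
  using nrm_triangle[of "x - y" "y - z"] by simp

text \<open>The type carries no topology of its own, since the norm depends on \<open>ip\<close>;
  convergence is therefore expressed by a real null sequence.\<close>

definition tends :: "(nat \<Rightarrow> 'e) \<Rightarrow> 'e \<Rightarrow> bool" where
  "tends X l \<longleftrightarrow> (\<lambda>n. nrm (X n - l)) \<longlonglongrightarrow> 0"

lemma tends_const: "tends (\<lambda>n. x) x"
  by (simp add: tends_def)

lemma tends_comparison:
  assumes "\<And>n. nrm (X n - l) \<le> f n" and "f \<longlonglongrightarrow> 0" shows "tends X l"
  unfolding tends_def by (rule tendsto_sandwich[OF _ _ tendsto_const assms(2)]) (auto simp: assms)

lemma tends_add:
  assumes "tends X l" "tends Y m" shows "tends (\<lambda>n. X n + Y n) (l + m)"
proof (rule tends_comparison)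
  show "(\<lambda>n. nrm (X n - l) + nrm (Y n - m)) \<longlonglongrightarrow> 0"
    using tendsto_add[OF assms[unfolded tends_def]] by simp
  show "nrm (X n + Y n - (l + m)) \<le> nrm (X n - l) + nrm (Y n - m)" for n
    using nrm_triangle[of "X n - l" "Y n - m"] by (simp add: algebra_simps)
qed

lemma tends_scaleC:
  assumes "tends X l" shows "tends (\<lambda>n. scaleC c (X n)) (scaleC c l)"
proof (rule tends_comparison)
  show "(\<lambda>n. cmod c * nrm (X n - l)) \<longlonglongrightarrow> 0"
    using tendsto_mult_left[OF assms[unfolded tends_def], of "cmod c"] by simp
qed (simp add: nrm_scaleC scaleC_diff_right[symmetric])

lemma tends_scaleR:
  assumes "tends X l" shows "tends (\<lambda>n. r *\<^sub>R X n) (r *\<^sub>R l)"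
  using tends_scaleC[OF assms] by (simp add: scaleR_scaleC)

lemma tends_ip_right:
  assumes "tends X l" shows "(\<lambda>n. ip y (X n)) \<longlonglongrightarrow> ip y l"
proof (rule LIM_zero_cancel, rule Lim_null_comparison)
  show "\<forall>\<^sub>F n in sequentially. norm (ip y (X n) - ip y l) \<le> nrm y * nrm (X n - l)"
    by (simp add: ip_diff_right[symmetric] ip_Cauchy_Schwarz)
  show "(\<lambda>n. nrm y * nrm (X n - l)) \<longlonglongrightarrow> 0"
    using tendsto_mult_left[OF assms[unfolded tends_def], of "nrm y"] by simp
qed

lemma bounded_linear_star: "bounded_linear (star :: 'a \<Rightarrow> 'a)"
  by (rule bounded_linear_intro[of _ 1]) (auto simp: star_add star_scaleR)

lemma tends_ip_left:
  assumes "tends X l" shows "(\<lambda>n. ip (X n) y) \<longlonglongrightarrow> ip l y"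
  using bounded_linear.tendsto[OF bounded_linear_star tends_ip_right[OF assms, of y]]
  by (simp add: ip_star)

lemma tends_unique:
  assumes "tends X l" "tends X m" shows "l = m"
  by (rule ip_eqI) (use LIMSEQ_unique[OF tends_ip_right[OF assms(1)] tends_ip_right[OF assms(2)]] in auto)

lemma tends_nrm:
  assumes "tends X l" shows "(\<lambda>n. nrm (X n)) \<longlonglongrightarrow> nrm l"
proof (rule LIM_zero_cancel, rule Lim_null_comparison)
  show "\<forall>\<^sub>F n in sequentially. norm (nrm (X n) - nrm l) \<le> nrm (X n - l)"
  proof (rule always_eventually, rule allI)
    fix n
    show "norm (nrm (X n) - nrm l) \<le> nrm (X n - l)"
      using nrm_triangle_mid[of "X n" 0 l] nrm_triangle_mid[of l 0 "X n"] nrm_minus_commute[of l "X n"]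
      by (simp add: abs_le_iff)
  qed
  show "(\<lambda>n. nrm (X n - l)) \<longlonglongrightarrow> 0"
    using assms by (simp add: tends_def)
qed

text \<open>Increments are compared with those of a scalar sequence because the square-root
  iteration need not converge geometrically when the norm of \<open>S\<close> is 1.\<close>

lemma tends_from_majorant:
  assumes "Cauchy q" and "\<And>m n. n \<le> m \<Longrightarrow> nrm (X m - X n) \<le> c * \<bar>q m - q n\<bar>"
  shows "\<exists>l. tends X l"
  unfolding tends_def
proof (rule complete)
  fix e :: real assume "e > 0"
  \<comment> \<open>\<open>c\<close> may be 0 or negative, hence the absolute value and the added
    1.\<close>
  define d where "d = e / (\<bar>c\<bar> + 1)"
  have "d > 0" using \<open>e > 0\<close> by (simp add: d_def)
  then obtain N where N: "\<And>m n. m \<ge> N \<Longrightarrow> n \<ge> N \<Longrightarrow> \<bar>q m - q n\<bar> < d"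
    using assms(1) unfolding Cauchy_def dist_real_def by blast
  have *: "nrm (X m - X n) < e" if "m \<ge> n" "n \<ge> N" for m n
  proof -
    have "nrm (X m - X n) \<le> \<bar>c\<bar> * \<bar>q m - q n\<bar>"
      by (rule order_trans[OF assms(2)[OF that(1)]]) (simp add: mult_right_mono)
    also have "\<dots> \<le> \<bar>c\<bar> * d"
      using N[of m n] that by (intro mult_left_mono) auto
    also have "\<dots> < (\<bar>c\<bar> + 1) * d"
      using \<open>d > 0\<close> by simp
    also have "\<dots> = e" by (simp add: d_def)
    finally show ?thesis .
  qed
  have "nrm (X m - X n) < e" if "m \<ge> N" "n \<ge> N" for m n
    using *[of n m] *[of m n] that by (cases "n \<le> m") (auto simp: nrm_minus_commute)
  then show "\<exists>N. \<forall>m\<ge>N. \<forall>n\<ge>N. nrm (X m - X n) < e" by blast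
qed

section \<open>Bounded operators, commutation and symmetry\<close>

definition bop :: "('e \<Rightarrow> 'e) \<Rightarrow> bool" where
  "bop T \<longleftrightarrow> (\<forall>x y. T (x + y) = T x + T y) \<and> (\<forall>c x. T (scaleC c x) = scaleC c (T x)) \<and>
    (\<exists>c. \<forall>x. nrm (T x) \<le> c * nrm x)"

lemma bopD:
  assumes "bop T"
  shows bop_add: "T (x + y) = T x + T y"
    and bop_scaleC: "T (scaleC c x) = scaleC c (T x)"
    and bop_scaleR: "T (r *\<^sub>R x) = r *\<^sub>R T x"
    and bop_zero: "T 0 = 0"
    and bop_minus: "T (- x) = - T x"
    and bop_diff: "T (x - y) = T x - T y"
proof -
  show add: "\<And>x y. T (x + y) = T x + T y" and C: "\<And>c x. T (scaleC c x) = scaleC c (T x)"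
    using assms by (auto simp: bop_def)
  show R: "T (r *\<^sub>R x) = r *\<^sub>R T x" for r x
    by (simp add: scaleR_scaleC C)
  show "T 0 = 0" using R[of 0 0] by simp
  show M: "T (- x) = - T x" for x using R[of "-1" x] by simp
  show "T (x - y) = T x - T y" using add[of x "-y"] M by simp
qed

lemma bop_bound:
  assumes "bop T" obtains c where "c > 0" "\<And>x. nrm (T x) \<le> c * nrm x"
proof -
  obtain c where c: "\<And>x. nrm (T x) \<le> c * nrm x" using assms by (auto simp: bop_def)
  have "nrm (T x) \<le> (\<bar>c\<bar> + 1) * nrm x" for x
    by (rule order_trans[OF c]) (auto intro!: mult_right_mono)
  then show thesis using that[of "\<bar>c\<bar> + 1"] by auto
qed

lemma tends_bop:
  assumes "bop T" "tends X l" shows "tends (\<lambda>n. T (X n)) (T l)"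
proof -
  obtain c where c: "c > 0" "\<And>x. nrm (T x) \<le> c * nrm x" using bop_bound[OF assms(1)] by blast
  show ?thesis
  proof (rule tends_comparison)
    show "(\<lambda>n. c * nrm (X n - l)) \<longlonglongrightarrow> 0"
      using tendsto_mult_left[OF assms(2)[unfolded tends_def], of c] by simp
    show "nrm (T (X n) - T l) \<le> c * nrm (X n - l)" for n
      using c(2)[of "X n - l"] by (simp add: bop_diff[OF assms(1)])
  qed
qed

lemma bop_plus:
  assumes S: "bop S" and T: "bop T" shows "bop (\<lambda>x. S x + T x)"
proof -
  obtain c where c: "c > 0" "\<And>x. nrm (S x) \<le> c * nrm x" using bop_bound[OF S] by blast
  obtain d where d: "d > 0" "\<And>x. nrm (T x) \<le> d * nrm x" using bop_bound[OF T] by blast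
  have "nrm (S x + T x) \<le> (c + d) * nrm x" for x
    using nrm_triangle[of "S x" "T x"] c(2)[of x] d(2)[of x] by (simp add: algebra_simps)
  then show ?thesis unfolding bop_def
    by (auto simp: bopD[OF S] bopD[OF T] scaleC_add_right)
qed

lemma bop_comp:
  assumes S: "bop S" and T: "bop T" shows "bop (\<lambda>x. S (T x))"
proof -
  obtain c where c: "c > 0" "\<And>x. nrm (S x) \<le> c * nrm x" using bop_bound[OF S] by blast
  obtain d where d: "d > 0" "\<And>x. nrm (T x) \<le> d * nrm x" using bop_bound[OF T] by blast
  have "nrm (S (T x)) \<le> (c * d) * nrm x" for x
    unfolding mult.assoc by (rule order_trans[OF c(2) mult_left_mono[OF d(2)]]) (use c(1) in simp)
  then show ?thesis unfolding bop_def by (auto simp: bopD[OF S] bopD[OF T])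
qed

lemma bop_scaled:
  assumes T: "bop T" shows "bop (\<lambda>x. scaleC k (T x))"
proof -
  obtain c where c: "c > 0" "\<And>x. nrm (T x) \<le> c * nrm x" using bop_bound[OF T] by blast
  have "nrm (scaleC k (T x)) \<le> (cmod k * c) * nrm x" for x
    using c(2)[of x] by (simp add: nrm_scaleC mult_left_mono mult.assoc)
  then show ?thesis unfolding bop_def
    by (auto simp: bopD[OF T] scaleC_add_right scaleC_scaleC mult.commute[of k] intro!: exI[of _ "cmod k * c"])
qed

lemma bop_scaledR:
  assumes "bop T" shows "bop (\<lambda>x. r *\<^sub>R T x)"
  using bop_scaled[OF assms, of "complex_of_real r"] by (simp add: scaleR_scaleC)

lemma bop_difference:
  assumes "bop S" "bop T" shows "bop (\<lambda>x. S x - T x)"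
  using bop_plus[OF assms(1) bop_scaledR[OF assms(2), of "-1"]] by simp

lemma bop_ident: "bop (\<lambda>x. x)"
  unfolding bop_def by (auto intro!: exI[of _ 1])

lemmas bop_intros = bop_plus bop_scaledR bop_difference bop_ident bop_scaled

text \<open>Stands in for \<open>R\<close> being a limit of polynomials in \<open>S\<close>.
  Commutation is all that later steps need of this, and it passes on to roots of roots.\<close>

definition in_bicommutant :: "('e \<Rightarrow> 'e) \<Rightarrow> ('e \<Rightarrow> 'e) \<Rightarrow> bool" where
  "in_bicommutant R S \<longleftrightarrow>
    (\<forall>U. bop U \<longrightarrow> (\<forall>x. U (S x) = S (U x)) \<longrightarrow> (\<forall>x. U (R x) = R (U x)))"

lemma in_bicommutantD:
  "in_bicommutant R S \<Longrightarrow> bop U \<Longrightarrow> (\<And>x. U (S x) = S (U x)) \<Longrightarrow> U (R x) = R (U x)"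
  by (auto simp: in_bicommutant_def)

definition symm :: "('e \<Rightarrow> 'e) \<Rightarrow> bool" where
  "symm T \<longleftrightarrow> bop T \<and> (\<forall>x y. ip (T x) y = ip x (T y))"

lemma symm_bop: "symm T \<Longrightarrow> bop T" and symm_ip: "symm T \<Longrightarrow> ip (T x) y = ip x (T y)"
  by (auto simp: symm_def)

lemma symm_plus: "symm S \<Longrightarrow> symm T \<Longrightarrow> symm (\<lambda>x. S x + T x)"
  and symm_difference: "symm S \<Longrightarrow> symm T \<Longrightarrow> symm (\<lambda>x. S x - T x)"
  and symm_scaled: "symm T \<Longrightarrow> symm (\<lambda>x. r *\<^sub>R T x)"
  and symm_ident: "symm (\<lambda>x. x)"
  by (auto simp: symm_def ip_simps intro: bop_intros)

lemma symm_comp: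
  "symm S \<Longrightarrow> symm T \<Longrightarrow> (\<And>x. S (T x) = T (S x)) \<Longrightarrow> symm (\<lambda>x. S (T x))"
  by (auto simp: symm_def intro: bop_comp)

lemmas symm_intros = symm_plus symm_difference symm_scaled symm_ident

lemma symm_nrm_power2: "symm T \<Longrightarrow> (nrm (T x))\<^sup>2 = norm (ip x (T (T x)))"
  by (simp add: nrm_power2 symm_ip)

text \<open>The squared norm of T x is the norm of <x, T^2 x>. Used repeatedly, this excludes
  nonzero nilpotent symmetric operators.\<close>

lemma symm_square_zero:
  assumes "symm T" "T (T x) = 0" shows "T x = 0"
  using symm_nrm_power2[OF assms(1), of x] assms(2) by simp

end

text \<open>The scalar iteration z = (s + z^2) / 2 from 0 in the extreme case s = 1. It bounds the
  operator iterates and their increments for every symmetric contraction.\<close>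

primrec sqrt_majorant :: "nat \<Rightarrow> real" where
  "sqrt_majorant 0 = 0"
| "sqrt_majorant (Suc n) = (1 + (sqrt_majorant n)\<^sup>2) / 2"

text \<open>The iteration \<open>z \<mapsto> (s + z\<^sup>2) / 2\<close> started at \<open>0\<close> tends to \<open>1 - \<surd>(1 - s)\<close>.\<close>

primrec sqrt_iter :: "('e::real_vector \<Rightarrow> 'e) \<Rightarrow> nat \<Rightarrow> 'e \<Rightarrow> 'e" where
  "sqrt_iter S 0 x = 0"
| "sqrt_iter S (Suc n) x = (1/2) *\<^sub>R (S x + sqrt_iter S n (sqrt_iter S n x))"

lemma sqrt_majorant_bounds: "0 \<le> sqrt_majorant n" "sqrt_majorant n \<le> 1"
proof -
  have "0 \<le> sqrt_majorant n \<and> sqrt_majorant n \<le> 1"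
    by (induction n) (auto simp: power_le_one)
  then show "0 \<le> sqrt_majorant n" "sqrt_majorant n \<le> 1" by auto
qed

lemma sqrt_majorant_mono: "m \<le> n \<Longrightarrow> sqrt_majorant m \<le> sqrt_majorant n"
proof (rule lift_Suc_mono_le[of sqrt_majorant])
  fix n
  have "0 \<le> (1 - sqrt_majorant n)\<^sup>2" by simp
  then show "sqrt_majorant n \<le> sqrt_majorant (Suc n)"
    by (simp add: power2_eq_square algebra_simps)
qed

lemma Cauchy_sqrt_majorant: "Cauchy sqrt_majorant"
proof -
  have "Bseq sqrt_majorant"
    by (rule BseqI'[of _ 1]) (use sqrt_majorant_bounds in \<open>simp add: abs_le_iff\<close>)
  moreover have "monoseq sqrt_majorant"
    using sqrt_majorant_mono by (simp add: monoseq_def)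
  ultimately show ?thesis
    using Bseq_monoseq_convergent convergent_Cauchy by blast
qed

section \<open>The square root of 1 - S for a symmetric contraction S\<close>

context ip_space
begin

context
  fixes S :: "'e \<Rightarrow> 'e"
  assumes S: "symm S" and contr: "\<And>x. nrm (S x) \<le> nrm x"
begin

private abbreviation "Z \<equiv> sqrt_iter S"

lemma sqrt_iter_symm_commute:
  "symm (Z n) \<and> (\<forall>U. bop U \<longrightarrow> (\<forall>x. U (S x) = S (U x)) \<longrightarrow> (\<forall>x. U (Z n x) = Z n (U x)))"
proof (induction n)
  case 0
  show ?case using symm_scaled[OF symm_ident, of 0] by (auto simp: bop_zero)
next
  case (Suc n)
  have "symm (\<lambda>x. (1/2) *\<^sub>R (S x + Z n (Z n x)))"
    using Suc S symm_comp[of "Z n" "Z n"] by (intro symm_scaled symm_plus) auto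
  moreover have "U (Z (Suc n) x) = Z (Suc n) (U x)"
    if "bop U" "\<forall>x. U (S x) = S (U x)" for U x
    using Suc that by (simp add: bopD[OF that(1)])
  ultimately show ?case by simp
qed

lemma sqrt_iter_symm: "symm (Z n)"
  using sqrt_iter_symm_commute by auto

lemma sqrt_iter_commute: "bop U \<Longrightarrow> (\<And>x. U (S x) = S (U x)) \<Longrightarrow> U (Z n x) = Z n (U x)"
  using sqrt_iter_symm_commute by blast

lemma sqrt_iter_commute': "Z m (Z n x) = Z n (Z m x)"
  by (rule sqrt_iter_commute[OF symm_bop[OF sqrt_iter_symm]])
    (use sqrt_iter_commute[OF symm_bop[OF S]] in auto)

lemma sqrt_iter_bound: "nrm (Z n x) \<le> sqrt_majorant n * nrm x"
proof (induction n arbitrary: x)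
  case (Suc n)
  have "nrm (Z n (Z n x)) \<le> sqrt_majorant n * (sqrt_majorant n * nrm x)"
    by (rule order_trans[OF Suc]) (intro mult_left_mono Suc sqrt_majorant_bounds)
  then show ?case
    using nrm_triangle[of "S x" "Z n (Z n x)"] contr[of x]
    unfolding sqrt_iter.simps nrm_scaleR by (simp add: algebra_simps power2_eq_square)
qed simp

text \<open>The iterates commute, so the difference of two squares factors as sum times difference.
  The majorant factors in the same way, and the induction closes.\<close>

lemma sqrt_iter_step:
  "nrm (Z (Suc n) x - Z n x) \<le> (sqrt_majorant (Suc n) - sqrt_majorant n) * nrm x"
proof (induction n arbitrary: x)
  case 0
  show ?case using contr[of x] by (simp add: nrm_scaleR)
next
  case (Suc n)
  let ?y = "Z (Suc n) x - Z n x" and ?p = "sqrt_majorant n" and ?q = "sqrt_majorant (Suc n)"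
  note lin = bopD[OF symm_bop[OF sqrt_iter_symm]]
  have "Z (Suc n) ?y + Z n ?y = Z (Suc n) (Z (Suc n) x) - Z n (Z n x)"
    unfolding lin using sqrt_iter_commute'[of "Suc n" n x] by (simp del: sqrt_iter.simps)
  then have eq: "Z (Suc (Suc n)) x - Z (Suc n) x = (1/2) *\<^sub>R (Z (Suc n) ?y + Z n ?y)"
    by (simp only: sqrt_iter.simps(2)[of S "Suc n"] sqrt_iter.simps(2)[of S n x]) (simp add: algebra_simps)
  have "nrm (Z (Suc n) ?y) \<le> ?q * ((?q - ?p) * nrm x)"
    by (rule order_trans[OF sqrt_iter_bound]) (intro mult_left_mono Suc sqrt_majorant_bounds)
  moreover have "nrm (Z n ?y) \<le> ?p * ((?q - ?p) * nrm x)"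
    by (rule order_trans[OF sqrt_iter_bound]) (intro mult_left_mono Suc sqrt_majorant_bounds)
  ultimately have "nrm (Z (Suc (Suc n)) x - Z (Suc n) x) \<le> (1/2) * (?q * ((?q - ?p) * nrm x) + ?p * ((?q - ?p) * nrm x))"
    unfolding eq nrm_scaleR using nrm_triangle[of "Z (Suc n) ?y" "Z n ?y"] by simp
  also have "\<dots> = (sqrt_majorant (Suc (Suc n)) - ?q) * nrm x"
    by (simp only: sqrt_majorant.simps(2)[of "Suc n"] sqrt_majorant.simps(2)[of n])
      (simp add: power2_eq_square field_simps)
  finally show ?case .
qed

lemma sqrt_iter_diff:
  "n \<le> m \<Longrightarrow> nrm (Z m x - Z n x) \<le> nrm x * \<bar>sqrt_majorant m - sqrt_majorant n\<bar>"
proof (induction m rule: dec_induct)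
  case (step k)
  have "nrm (Z (Suc k) x - Z n x)
      \<le> (sqrt_majorant (Suc k) - sqrt_majorant k) * nrm x + nrm x * (sqrt_majorant k - sqrt_majorant n)"
    using nrm_triangle_mid[of "Z (Suc k) x" "Z n x" "Z k x"] sqrt_iter_step[of k x] step
      sqrt_majorant_mono[of n k] by simp
  also have "\<dots> = nrm x * \<bar>sqrt_majorant (Suc k) - sqrt_majorant n\<bar>"
    using sqrt_majorant_mono[of n "Suc k"] step(1) by (simp del: sqrt_majorant.simps add: algebra_simps)
  finally show ?case .
qed simp

text \<open>The limit \<open>Y\<close> of the iterates satisfies 2 Y = S + Y^2, that is (1 - Y)^2 =
  1 - S, and R = 1 - Y. The bound on x - R x, which is Y x, later makes \<open>R\<close> a positive
  root.\<close>

lemma symm_sqrt: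
  obtains R where "symm R" "\<And>x. R (R x) = x - S x" "\<And>x. nrm (x - R x) \<le> nrm x"
    "in_bicommutant R S"
proof -
  have "\<exists>l. tends (\<lambda>n. Z n x) l" for x
    by (rule tends_from_majorant[OF Cauchy_sqrt_majorant sqrt_iter_diff])
  then obtain Y where Y: "\<And>x. tends (\<lambda>n. Z n x) (Y x)" by metis
  note lin = bopD[OF symm_bop[OF sqrt_iter_symm]]
  have Y_add: "Y (x + y) = Y x + Y y" for x y
    using tends_unique[OF Y[of "x + y"]] tends_add[OF Y[of x] Y[of y]] lin by auto
  have Y_scaleC: "Y (scaleC c x) = scaleC c (Y x)" for c x
    using tends_unique[OF Y[of "scaleC c x"]] tends_scaleC[OF Y[of x], of c] lin by auto
  have Zle: "nrm (Z n x) \<le> nrm x" for n x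
    using order_trans[OF sqrt_iter_bound mult_right_mono[OF sqrt_majorant_bounds(2)]] by simp
  have Yle: "nrm (Y x) \<le> nrm x" for x
    by (rule LIMSEQ_le_const2[OF tends_nrm[OF Y]]) (use Zle in blast)
  have bY: "bop Y" unfolding bop_def using Y_add Y_scaleC Yle by (auto intro!: exI[of _ 1])
  have "ip (Y x) y = ip x (Y y)" for x y
    using LIMSEQ_unique[OF tends_ip_left[OF Y[of x], of y]] tends_ip_right[OF Y[of y], of x]
    by (simp add: symm_ip[OF sqrt_iter_symm])
  with bY have sY: "symm Y" by (simp add: symm_def)
  have YY: "2 *\<^sub>R Y x = S x + Y (Y x)" for x
  proof -
    \<comment> \<open>Operator and argument both vary with n; the uniform bound \<open>Zle\<close>
      absorbs the change of the argument.\<close>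
    have "tends (\<lambda>n. Z n (Z n x)) (Y (Y x))"
    proof (rule tends_comparison)
      show "(\<lambda>n. nrm (Z n x - Y x) + nrm (Z n (Y x) - Y (Y x))) \<longlonglongrightarrow> 0"
        using tendsto_add[OF Y[of x, unfolded tends_def] Y[of "Y x", unfolded tends_def]] by simp
      show "nrm (Z n (Z n x) - Y (Y x)) \<le> nrm (Z n x - Y x) + nrm (Z n (Y x) - Y (Y x))" for n
        using nrm_triangle_mid[of "Z n (Z n x)" "Y (Y x)" "Z n (Y x)"] Zle[of n "Z n x - Y x"]
        by (simp add: lin)
    qed
    then have "tends (\<lambda>n. Z (Suc n) x) ((1/2) *\<^sub>R (S x + Y (Y x)))"
      by (simp add: tends_scaleR tends_add tends_const)
    moreover have "tends (\<lambda>n. Z (Suc n) x) (Y x)"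
      using Y[of x] unfolding tends_def by (rule LIMSEQ_Suc)
    ultimately have "Y x = (1/2) *\<^sub>R (S x + Y (Y x))" by (rule tends_unique[rotated])
    then have "2 *\<^sub>R Y x = 2 *\<^sub>R ((1/2) *\<^sub>R (S x + Y (Y x)))" by (rule arg_cong)
    then show ?thesis by simp
  qed
  show thesis
  proof (rule that[of "\<lambda>x. x - Y x"])
    show "symm (\<lambda>x. x - Y x)" by (intro symm_intros sY)
    show "x - Y x - Y (x - Y x) = x - S x" for x
      using YY[of x] by (simp add: bopD[OF bY] scaleR_2 algebra_simps)
    show "nrm (x - (x - Y x)) \<le> nrm x" for x using Yle by simp
    show "in_bicommutant (\<lambda>x. x - Y x) S"
      unfolding in_bicommutant_def
    proof (intro allI impI)
      fix U x assume U: "bop U" and c: "\<forall>x. U (S x) = S (U x)"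
      have "U (Z n x) = Z n (U x)" for n using sqrt_iter_commute[OF U] c by blast
      then show "U (x - Y x) = U x - Y (U x)"
        using tends_unique[OF tends_bop[OF U Y[of x]]] Y[of "U x"] by (simp add: bop_diff[OF U])
    qed
  qed
qed

end

end

section \<open>Positive operators\<close>

lemma le_mult_if_power2_le:
  fixes a b t :: real
  assumes "a\<^sup>2 \<le> t * (t * b\<^sup>2)" "0 \<le> t" "0 \<le> b" shows "a \<le> t * b"
  by (rule power2_le_imp_le) (use assms in \<open>auto simp: power2_eq_square algebra_simps\<close>)

context ip_space
begin

text \<open>\<open>B + \<i> R\<close> is \<open>\<surd>t\<close> times a unitary.\<close>

lemma symm_pythagoras:
  assumes B: "symm B" and R: "symm R" and comm: "\<And>x. B (R x) = R (B x)"
    and sum: "\<And>x. B (B x) + R (R x) = t *\<^sub>R x" and "t \<ge> 0"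
  shows "(nrm (B x))\<^sup>2 \<le> t * (nrm x)\<^sup>2"
proof -
  \<comment> \<open>Monotonicity of the norm on positive elements is not yet available, so <B x, B
    x> cannot be compared with <B x, B x> + <R x, R x>. Instead B x is the mean of two vectors of
    norm sqrt t * \<open>nrm x\<close>.\<close>
  define u where "u = (\<lambda>k. B x + scaleC k (R x))"
  have u: "nrm (u k) = sqrt t * nrm x" if k: "k = \<i> \<or> k = - \<i>" for k
  proof -
    have kk: "cnj k = - k" "k * k = -1" using k by auto
    have "ip (u k) (u k) = ip x (B (B x)) + scaleC k (ip x (B (R x))) + scaleC (cnj k) (ip x (R (B x)))
        + scaleC (cnj k * k) (ip x (R (R x)))"
      unfolding u_def by (simp add: ip_simps ip_scaleC_left ip_scaleC_right symm_ip[OF B] symm_ip[OF R]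
          scaleC_scaleC scaleC_add_right mult.commute)
    also have "\<dots> = ip x (B (B x)) + ip x (R (R x))"
    proof -
      have "scaleC k y + scaleC (cnj k) y = 0" for y :: 'a
        using scaleC_add_left[of k "cnj k" y] scaleC_add_left[of 0 0 y] by (simp add: kk)
      moreover have "cnj k * k = 1" using kk by simp
      ultimately show ?thesis by (simp add: comm scaleC_one add.assoc)
    qed
    also have "\<dots> = t *\<^sub>R ip x x"
      using sum[of x] by (simp add: ip_simps flip: ip_add_right)
    finally have "(nrm (u k))\<^sup>2 = (sqrt t * nrm x)\<^sup>2"
      using \<open>t \<ge> 0\<close> by (simp add: nrm_power2 power_mult_distrib)
    then show ?thesis using \<open>t \<ge> 0\<close> by (simp add: power2_eq_iff_nonneg)
  qed
  have "scaleC \<i> (R x) + scaleC (- \<i>) (R x) = 0"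
    using scaleC_add_left[of \<i> "- \<i>" "R x"] scaleR_scaleC[of 0 "R x"] by simp
  then have "2 *\<^sub>R B x = u \<i> + u (- \<i>)"
    unfolding u_def by (simp add: scaleR_2 algebra_simps)
  then have "2 * nrm (B x) = nrm (u \<i> + u (- \<i>))"
    by (metis abs_numeral nrm_scaleR)
  also have "\<dots> \<le> 2 * (sqrt t * nrm x)"
    using nrm_triangle[of "u \<i>" "u (- \<i>)"] u by simp
  finally have "(nrm (B x))\<^sup>2 \<le> (sqrt t * nrm x)\<^sup>2" by (simp add: power_mono)
  then show ?thesis using \<open>t \<ge> 0\<close> by (simp add: power_mult_distrib)
qed

text \<open>The spectrum lies in \<open>[0, 2t]\<close>; phrased by norms, this notion is obviously stable under
  sums.\<close>

definition npos :: "('e \<Rightarrow> 'e) \<Rightarrow> bool" where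
  "npos T \<longleftrightarrow> symm T \<and> (\<exists>t\<ge>0. \<forall>x. nrm (t *\<^sub>R x - T x) \<le> t * nrm x)"

lemma npos_symm: "npos T \<Longrightarrow> symm T"
  by (simp add: npos_def)

lemma npos_plus:
  assumes "npos S" "npos T" shows "npos (\<lambda>x. S x + T x)"
proof -
  obtain s where s: "s \<ge> 0" "\<And>x. nrm (s *\<^sub>R x - S x) \<le> s * nrm x" using assms(1) by (auto simp: npos_def)
  obtain t where t: "t \<ge> 0" "\<And>x. nrm (t *\<^sub>R x - T x) \<le> t * nrm x" using assms(2) by (auto simp: npos_def)
  have "nrm ((s + t) *\<^sub>R x - (S x + T x)) \<le> (s + t) * nrm x" for x
    using nrm_triangle[of "s *\<^sub>R x - S x" "t *\<^sub>R x - T x"] s(2)[of x] t(2)[of x]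
    by (simp add: algebra_simps)
  moreover have "symm (\<lambda>x. S x + T x)" using assms by (intro symm_plus npos_symm)
  ultimately show ?thesis using s(1) t(1) unfolding npos_def by (auto intro!: exI[of _ "s + t"])
qed

lemma npos_scaled:
  assumes "npos T" "r \<ge> 0" shows "npos (\<lambda>x. r *\<^sub>R T x)"
proof -
  obtain t where t: "t \<ge> 0" "\<And>x. nrm (t *\<^sub>R x - T x) \<le> t * nrm x" using assms(1) by (auto simp: npos_def)
  have "nrm ((r * t) *\<^sub>R x - r *\<^sub>R T x) \<le> (r * t) * nrm x" for x
  proof -
    have "(r * t) *\<^sub>R x - r *\<^sub>R T x = r *\<^sub>R (t *\<^sub>R x - T x)" by (simp add: algebra_simps)
    then show ?thesis using mult_left_mono[OF t(2)[of x] assms(2)] assms(2) by (simp add: nrm_scaleR)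
  qed
  then show ?thesis using t(1) assms unfolding npos_def
    by (auto intro!: exI[of _ "r * t"] symm_scaled)
qed

text \<open>For t large, S = 1 - T / t is a symmetric contraction, and sqrt t times the root of 1 -
  S squares to \<open>T\<close>. The root is positive in the same sense, so it can be rooted
  again.\<close>

lemma npos_sqrt:
  assumes "npos T"
  obtains D where "npos D" "\<And>x. D (D x) = T x"
    "in_bicommutant D T"
proof -
  have T: "symm T" using assms by (rule npos_symm)
  obtain t0 where t0: "t0 \<ge> 0" "\<And>x. nrm (t0 *\<^sub>R x - T x) \<le> t0 * nrm x"
    using assms by (auto simp: npos_def)
  \<comment> \<open>The added 1 allows division by t; enlarging t preserves the norm
    inequality.\<close>
  define t where "t = t0 + 1"
  have "t > 0" using t0 by (simp add: t_def)
  have t: "nrm (t *\<^sub>R x - T x) \<le> t * nrm x" for x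
    using nrm_triangle[of "t0 *\<^sub>R x - T x" x] t0(2)[of x] by (simp add: t_def algebra_simps)
  define S where "S = (\<lambda>x. x - (1/t) *\<^sub>R T x)"
  have "symm S" unfolding S_def by (intro symm_intros T)
  moreover have "nrm (S x) \<le> nrm x" for x
  proof -
    have "S x = (1/t) *\<^sub>R (t *\<^sub>R x - T x)" using \<open>t > 0\<close> by (simp add: S_def algebra_simps)
    then have "nrm (S x) = (1/t) * nrm (t *\<^sub>R x - T x)" using \<open>t > 0\<close> by (simp add: nrm_scaleR)
    also have "\<dots> \<le> (1/t) * (t * nrm x)" using \<open>t > 0\<close> by (intro mult_left_mono t) auto
    finally show ?thesis using \<open>t > 0\<close> by simp
  qed
  ultimately obtain R where R: "symm R" "\<And>x. R (R x) = x - S x" "\<And>x. nrm (x - R x) \<le> nrm x"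
    "in_bicommutant R S"
    by (rule symm_sqrt) (rule that)
  define D where "D = (\<lambda>x. sqrt t *\<^sub>R R x)"
  have "symm D" unfolding D_def by (intro symm_intros R)
  moreover have "nrm (sqrt t *\<^sub>R x - D x) \<le> sqrt t * nrm x" for x
    using R(3)[of x] \<open>t > 0\<close> by (simp add: D_def nrm_scaleR flip: scaleR_diff_right)
  ultimately have "npos D" unfolding npos_def using \<open>t > 0\<close> by (intro conjI exI[of _ "sqrt t"]) auto
  moreover have "D (D x) = T x" for x
    using \<open>t > 0\<close> R(2)[of x] by (simp add: D_def bopD[OF symm_bop[OF R(1)]] S_def)
  moreover have "in_bicommutant D T"
    unfolding in_bicommutant_def
  proof (intro allI impI)
    fix U x assume U: "bop U" "\<forall>x. U (T x) = T (U x)"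
    have "U (R x) = R (U x)"
      by (rule in_bicommutantD[OF R(4) U(1)]) (use U(2) in \<open>simp add: S_def bopD[OF U(1)]\<close>)
    then show "U (D x) = D (U x)" by (simp add: D_def bopD[OF U(1)])
  qed
  ultimately show thesis by (rule that)
qed

text \<open>With R the root of 1 - B^2 / t and C = B / sqrt t one has R^2 + C^2 = 1. So R is a
  contraction, and t - B^2 = t R^2.\<close>

lemma square_gap_bound:
  assumes B: "symm B" and "t \<ge> 0" and bd: "\<And>x. (nrm (B x))\<^sup>2 \<le> t * (nrm x)\<^sup>2"
  shows "nrm (t *\<^sub>R x - B (B x)) \<le> t * nrm x"
proof (cases "t = 0")
  case True
  then show ?thesis using bd by simp
next
  case False
  then have "t > 0" using \<open>t \<ge> 0\<close> by simp
  define S where "S = (\<lambda>x. (1/t) *\<^sub>R B (B x))"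
  have S: "symm S" unfolding S_def by (rule symm_scaled, rule symm_comp[OF B B refl])
  have "(nrm (B (B x)))\<^sup>2 \<le> t * (t * (nrm x)\<^sup>2)" for x
    by (rule order_trans[OF bd mult_left_mono[OF bd \<open>t \<ge> 0\<close>]])
  then have "nrm (B (B x)) \<le> t * nrm x" for x
    using \<open>t \<ge> 0\<close> by (rule le_mult_if_power2_le) simp
  then have "nrm (S x) \<le> nrm x" for x
    using \<open>t > 0\<close> by (simp add: S_def nrm_scaleR field_simps)
  with S obtain R where R: "symm R" "\<And>x. R (R x) = x - S x" "\<And>x. nrm (x - R x) \<le> nrm x"
    "in_bicommutant R S"
    by (rule symm_sqrt) (rule that)
  note lB = bopD[OF symm_bop[OF B]]
  have BR: "B (R x) = R (B x)" for x
    by (rule in_bicommutantD[OF R(4)]) (auto simp: S_def lB symm_bop[OF B])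
  define C where "C = (\<lambda>x. (1 / sqrt t) *\<^sub>R B x)"
  have C: "symm C" unfolding C_def by (intro symm_scaled B)
  have RC: "R (C x) = C (R x)" for x
    by (simp add: C_def bopD[OF symm_bop[OF R(1)]] BR)
  have "R (R x) + C (C x) = 1 *\<^sub>R x" for x
    using \<open>t > 0\<close> by (simp add: C_def lB R(2) S_def)
  from symm_pythagoras[OF R(1) C RC this] have "(nrm (R x))\<^sup>2 \<le> (nrm x)\<^sup>2" for x by simp
  then have Rle: "nrm (R x) \<le> nrm x" for x by (rule power2_le_imp_le) simp
  have "t *\<^sub>R x - B (B x) = t *\<^sub>R R (R x)"
    using \<open>t > 0\<close> by (simp add: R(2) S_def algebra_simps)
  then show ?thesis
    using order_trans[OF Rle Rle, of x] \<open>t > 0\<close> by (simp add: nrm_scaleR)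
qed

lemma npos_square:
  assumes B: "symm B" shows "npos (\<lambda>x. B (B x))"
proof -
  obtain c where c: "c > 0" "\<And>x. nrm (B x) \<le> c * nrm x" using bop_bound[OF symm_bop[OF B]] by blast
  have "(nrm (B x))\<^sup>2 \<le> c\<^sup>2 * (nrm x)\<^sup>2" for x
    using power_mono[OF c(2)[of x], of 2] by (simp add: power_mult_distrib)
  then have "nrm (c\<^sup>2 *\<^sub>R x - B (B x)) \<le> c\<^sup>2 * nrm x" for x
    by (intro square_gap_bound B) auto
  then show ?thesis unfolding npos_def using symm_comp[OF B B]
    by (intro conjI exI[of _ "c\<^sup>2"]) auto
qed

text \<open>The roots of T and of t - T commute and their squares add up to t, so the root of T has
  norm at most sqrt t.\<close>

lemma npos_norm_le:
  assumes T: "npos T" and gap: "npos (\<lambda>x. t *\<^sub>R x - T x)" and "t \<ge> 0"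
  shows "nrm (T x) \<le> t * nrm x"
proof -
  obtain B where B: "npos B" "\<And>x. B (B x) = T x"
    "in_bicommutant B T"
    by (rule npos_sqrt[OF T]) (rule that)
  obtain R where R: "npos R" "\<And>x. R (R x) = t *\<^sub>R x - T x"
    "in_bicommutant R (\<lambda>x. t *\<^sub>R x - T x)"
    by (rule npos_sqrt[OF gap]) (rule that)
  note sB = npos_symm[OF B(1)]
  have "B (T x) = T (B x)" for x by (simp flip: B(2))
  then have BR: "B (R x) = R (B x)" for x
    by (intro in_bicommutantD[OF R(3)]) (simp_all add: symm_bop[OF sB] bopD[OF symm_bop[OF sB]])
  have *: "(nrm (B x))\<^sup>2 \<le> t * (nrm x)\<^sup>2" for x
    by (rule symm_pythagoras[OF sB npos_symm[OF R(1)] BR]) (auto simp: B R \<open>t \<ge> 0\<close>)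
  have "(nrm (T x))\<^sup>2 \<le> t * (t * (nrm x)\<^sup>2)"
    unfolding B(2)[symmetric] by (rule order_trans[OF * mult_left_mono[OF * \<open>t \<ge> 0\<close>]])
  then show ?thesis
    using \<open>t \<ge> 0\<close> by (rule le_mult_if_power2_le) simp
qed

text \<open>\<open>D\<^sup>2 = \<bar>T\<bar>\<close>, and \<open>N\<close> is the negative part of \<open>T\<close>.\<close>

lemma symm_negative_part:
  assumes T: "symm T"
  obtains D N where "symm D" "symm N" "\<And>x. D (D x) - T x = 2 *\<^sub>R N x" "\<And>x. D (D (N x)) = N (N x)"
    "\<And>x. T (N x) = - N (N x)" "\<And>x. N (T x) = T (N x)" "\<And>x. N (D x) = D (N x)"
proof -
  obtain A where A: "npos A" "\<And>x. A (A x) = T (T x)"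
    "in_bicommutant A (\<lambda>x. T (T x))"
    by (rule npos_sqrt[OF npos_square[OF T]]) (rule that)
  obtain D where D: "npos D" "\<And>x. D (D x) = A x"
    "in_bicommutant D A"
    by (rule npos_sqrt[OF A(1)]) (rule that)
  note lT = bopD[OF symm_bop[OF T]] and lA = bopD[OF symm_bop[OF npos_symm[OF A(1)]]]
    and lD = bopD[OF symm_bop[OF npos_symm[OF D(1)]]]
  have TA: "T (A x) = A (T x)" for x by (rule in_bicommutantD[OF A(3)]) (auto simp: symm_bop[OF T])
  have TD: "T (D x) = D (T x)" for x by (rule in_bicommutantD[OF D(3)]) (auto simp: symm_bop[OF T] TA)
  \<comment> \<open>\<open>A\<close> is the absolute value of \<open>T\<close>. From A^2 = T^2 and
    commutation follow A N = N^2 and T N = - N^2.\<close>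
  define N where "N = (\<lambda>x. (1/2) *\<^sub>R (A x - T x))"
  have *: "N (N x) = (1/2) *\<^sub>R (A (A x) - A (T x))" "A (N x) = (1/2) *\<^sub>R (A (A x) - A (T x))"
      "T (N x) = - (1/2) *\<^sub>R (A (A x) - A (T x))" for x
  proof -
    show "A (N x) = (1/2) *\<^sub>R (A (A x) - A (T x))" by (simp add: N_def lA)
    have "N (N x) = (1/4) *\<^sub>R ((A (A x) - A (T x)) + (A (A x) - A (T x)))"
      by (simp add: N_def lA lT TA A(2) algebra_simps)
    then show "N (N x) = (1/2) *\<^sub>R (A (A x) - A (T x))"
      by (simp only: scaleR_2[symmetric]) simp
    show "T (N x) = - (1/2) *\<^sub>R (A (A x) - A (T x))"
      by (simp add: N_def lT TA A(2) algebra_simps)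
  qed
  show thesis
  proof (rule that[of D N])
    show "symm D" by (rule npos_symm[OF D(1)])
    show "symm N" unfolding N_def by (intro symm_intros T npos_symm[OF A(1)])
    show "D (D x) - T x = 2 *\<^sub>R N x" for x by (simp add: D(2) N_def)
    show "D (D (N x)) = N (N x)" "T (N x) = - N (N x)" for x by (simp_all add: * D(2))
    show "N (T x) = T (N x)" for x by (simp add: N_def TA lT)
    show "N (D x) = D (N x)" for x by (simp add: N_def TD lD flip: D(2))
  qed
qed

text \<open>Positivity tests on the range of N yield the vanishing of some power of N only; symmetry
  then gives N = 0 and T = D^2.\<close>

lemma square_if_negative_part_zero:
  assumes "symm D" "symm N" "\<And>x. D (D x) - T x = 2 *\<^sub>R N x" "\<And>x. D (D (N x)) = N (N x)"
    and "\<And>x. N (N (N x)) = 0"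
  shows "D (D x) = T x"
proof -
  have "N (N x) = 0" for x using symm_square_zero[OF assms(2)] assms(5) by blast
  then have "N x = 0" using symm_square_zero[OF assms(2)] by blast
  then show ?thesis using assms(3)[of x] by simp
qed

section \<open>Positivity of an adjoint times the operator itself\<close>

lemma adjoint_bop_bound:
  assumes adj: "\<And>x y. ip (c x) y = ip x (c' y)" and bd: "\<And>x. nrm (c x) \<le> k * nrm x"
  shows "nrm (c' x) \<le> k * nrm x"
proof (cases "nrm (c' x) = 0")
  case True
  then show ?thesis using bd[of x] order_trans[OF nrm_ge_0] by auto
next
  case False
  have "(nrm (c' x))\<^sup>2 \<le> nrm (c (c' x)) * nrm x"
    unfolding nrm_power2 adj[symmetric] by (rule ip_Cauchy_Schwarz)
  also have "\<dots> \<le> (k * nrm (c' x)) * nrm x"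
    by (intro mult_right_mono bd) simp
  finally have "nrm (c' x) * nrm (c' x) \<le> nrm (c' x) * (k * nrm x)"
    by (simp add: power2_eq_square algebra_simps)
  then show ?thesis using False nrm_ge_0[of "c' x"] by (auto simp: mult_le_cancel_left)
qed

text \<open>If \<open>c\<^sup>* c = - m\<^sup>2\<close> then \<open>q = c c\<^sup>*\<close> is positive as well, because \<open>c\<^sup>* c + c c\<^sup>*\<close> is a sum of
  squares. If \<open>\<parallel>q\<parallel> \<le> t\<close>, then \<open>\<parallel>(t + q) q\<parallel> = \<parallel>c (t - m\<^sup>2) c\<^sup>*\<parallel> \<le> t\<^sup>2\<close>, whence \<open>2 q\<^sup>2 \<le> t q + q\<^sup>2 \<le> t\<^sup>2\<close>
  and \<open>\<parallel>q\<parallel> \<le> t / \<surd>2\<close>. Repeating this gives \<open>q = 0\<close>.\<close>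

lemma adjoint_times_self_not_negative:
  assumes c: "bop c" and c': "bop c'" and adj: "\<And>x y. ip (c x) y = ip x (c' y)"
    and m: "symm m" and neg: "\<And>x. c' (c x) = - m (m x)"
  shows "c x = 0"
proof -
  note lc = bopD[OF c] and lc' = bopD[OF c'] and lm = bopD[OF symm_bop[OF m]]
  have adj': "ip (c' x) y = ip x (c y)" for x y by (metis adj ip_star)
  define q where "q = (\<lambda>x. c (c' x))"
  have sq: "symm q" unfolding q_def symm_def using bop_comp[OF c c'] by (auto simp: adj adj')
  \<comment> \<open>Real and imaginary part of \<open>c\<close>. Twice the sum of their squares is
    c' c + c c', and c' c = - m^2, so q = 2 h^2 + 2 l^2 + m^2.\<close>
  define h where "h = (\<lambda>x. (1/2) *\<^sub>R (c x + c' x))"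
  define l where "l = (\<lambda>x. scaleC (- \<i> / 2) (c x - c' x))"
  have h: "symm h" unfolding h_def symm_def
    by (auto intro!: bop_intros c c' simp: adj adj' ip_simps add.commute)
  have "symm l" unfolding l_def symm_def
  proof (intro conjI allI)
    fix x y
    have "scaleC (\<i> / 2) (ip x (c' y) - ip x (c y)) = scaleC (- \<i> / 2) (ip x (c y) - ip x (c' y))"
      using scaleC_scaleC[of "\<i> / 2" "-1" "ip x (c y) - ip x (c' y)"] by (simp add: scaleC_minus_one)
    then show "ip (scaleC (- \<i> / 2) (c x - c' x)) y = ip x (scaleC (- \<i> / 2) (c y - c' y))"
      by (simp add: ip_scaleC_left ip_scaleC_right adj adj' ip_diff_left ip_diff_right)
  qed (intro bop_intros c c')
  note l = this
  have sum_squares: "q x = 2 *\<^sub>R h (h x) + 2 *\<^sub>R l (l x) + m (m x)" for x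
  proof -
    have hh: "h (h x) = (1/4) *\<^sub>R (c (c x) + c (c' x) + c' (c x) + c' (c' x))"
      by (simp add: h_def lc lc' algebra_simps)
    have "l (l x) = scaleC (- \<i> / 2) (scaleC (- \<i> / 2) ((c (c x) - c (c' x)) - (c' (c x) - c' (c' x))))"
      unfolding l_def by (simp add: lc lc' scaleC_diff_right)
    also have "\<dots> = scaleC (complex_of_real (- (1/4))) ((c (c x) - c (c' x)) - (c' (c x) - c' (c' x)))"
      by (simp add: scaleC_scaleC)
    also have "\<dots> = (- (1/4)) *\<^sub>R ((c (c x) - c (c' x)) - (c' (c x) - c' (c' x)))"
      by (simp only: scaleR_scaleC)
    finally have ll: "l (l x) = (1/4) *\<^sub>R (c (c' x) + c' (c x) - c (c x) - c' (c' x))"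
      by (simp add: algebra_simps)
    have "2 *\<^sub>R h (h x) + 2 *\<^sub>R l (l x) = (1/2) *\<^sub>R ((c (c' x) + c' (c x)) + (c (c' x) + c' (c x)))"
      unfolding hh ll by (simp add: algebra_simps)
    also have "\<dots> = c (c' x) + c' (c x)" by (simp only: scaleR_2[symmetric]) simp
    finally show ?thesis by (simp add: q_def neg)
  qed
  have "npos (\<lambda>x. 2 *\<^sub>R h (h x) + 2 *\<^sub>R l (l x) + m (m x))"
    by (intro npos_plus npos_scaled[of "\<lambda>x. h (h x)"] npos_scaled[of "\<lambda>x. l (l x)"] npos_square h l m) auto
  then have "npos q" unfolding sum_squares[symmetric] by simp
  then obtain g where g: "npos g" "\<And>x. g (g x) = q x" using npos_sqrt by (metis (full_types))
  note sg = npos_symm[OF g(1)]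
  have step: "(nrm (c x))\<^sup>2 \<le> (t / sqrt 2) * (nrm x)\<^sup>2"
    if "t \<ge> 0" and ct: "\<And>x. (nrm (c x))\<^sup>2 \<le> t * (nrm x)\<^sup>2" for t x
  proof -
    have ct1: "nrm (c x) \<le> sqrt t * nrm x" for x
      by (rule power2_le_imp_le) (use ct \<open>t \<ge> 0\<close> in \<open>auto simp: power_mult_distrib\<close>)
    have ct1': "nrm (c' x) \<le> sqrt t * nrm x" for x
      by (rule adjoint_bop_bound[OF adj ct1])
    have mt: "(nrm (m x))\<^sup>2 \<le> t * (nrm x)\<^sup>2" for x
    proof -
      have "(nrm (m x))\<^sup>2 = norm (ip x (c' (c x)))"
        by (simp add: symm_nrm_power2[OF m] neg ip_minus_right)
      also have "\<dots> = (nrm (c x))\<^sup>2" by (simp add: nrm_power2 adj)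
      finally show ?thesis using ct by simp
    qed
    have gt: "(nrm (g x))\<^sup>2 \<le> t * (nrm x)\<^sup>2" for x
    proof -
      have "(nrm (g x))\<^sup>2 = (nrm (c' x))\<^sup>2"
        unfolding symm_nrm_power2[OF sg] g(2) by (simp add: q_def nrm_power2 adj')
      also have "\<dots> \<le> (sqrt t * nrm x)\<^sup>2" by (intro power_mono ct1') simp
      finally show ?thesis using \<open>t \<ge> 0\<close> by (simp add: power_mult_distrib)
    qed
    define w where "w = (\<lambda>x. t *\<^sub>R q x + q (q x))"
    have wt: "nrm (w x) \<le> t\<^sup>2 * nrm x" for x
    proof -
      have "w x = c (t *\<^sub>R c' x - m (m (c' x)))"
        by (simp add: w_def q_def lc neg)
      then have "nrm (w x) \<le> sqrt t * nrm (t *\<^sub>R c' x - m (m (c' x)))"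
        by (simp add: ct1)
      also have "\<dots> \<le> sqrt t * (t * nrm (c' x))"
        using \<open>t \<ge> 0\<close> by (intro mult_left_mono square_gap_bound m mt) auto
      also have "\<dots> \<le> sqrt t * (t * (sqrt t * nrm x))"
        using \<open>t \<ge> 0\<close> by (intro mult_left_mono ct1') auto
      also have "\<dots> = (sqrt t * sqrt t) * t * nrm x"
        by (simp only: mult_ac)
      finally show ?thesis using \<open>t \<ge> 0\<close> by (simp add: power2_eq_square)
    qed
    have "symm (\<lambda>x. q (q x))" using symm_comp[OF sq sq] by simp
    then have "symm w" unfolding w_def by (intro symm_plus symm_scaled sq)
    then have "npos (\<lambda>x. t\<^sup>2 *\<^sub>R x - w x)"
      unfolding npos_def using wt by (intro conjI symm_intros exI[of _ "t\<^sup>2"]) auto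
    \<comment> \<open>With commuting roots g of q and r of t - q, this operator is the square of g
      r.\<close>
    moreover have "npos (\<lambda>x. t *\<^sub>R q x - q (q x))"
    proof -
      have "npos (\<lambda>x. t *\<^sub>R x - q x)"
        unfolding npos_def
      proof (intro conjI exI[of _ t] allI)
        show "nrm (t *\<^sub>R x - (t *\<^sub>R x - q x)) \<le> t * nrm x" for x
        proof -
          have "(nrm (q x))\<^sup>2 \<le> t * (t * (nrm x)\<^sup>2)"
            unfolding g(2)[symmetric] by (rule order_trans[OF gt mult_left_mono[OF gt \<open>t \<ge> 0\<close>]])
          then have "nrm (q x) \<le> t * nrm x"
            using \<open>t \<ge> 0\<close> by (rule le_mult_if_power2_le) simp
          then show ?thesis by simp
        qed
      qed (use \<open>t \<ge> 0\<close> in \<open>auto intro!: symm_intros sq\<close>)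
      then obtain r where r: "npos r" "\<And>x. r (r x) = t *\<^sub>R x - q x"
        "in_bicommutant r (\<lambda>x. t *\<^sub>R x - q x)"
        by (rule npos_sqrt) (rule that)
      have gr: "g (r x) = r (g x)" for x
        by (rule in_bicommutantD[OF r(3)]) (simp_all add: symm_bop[OF sg] bopD[OF symm_bop[OF sg]] flip: g(2))
      have "npos (\<lambda>x. g (r (g (r x))))"
        using npos_square[OF symm_comp[OF sg npos_symm[OF r(1)] gr]] .
      moreover have "g (r (g (r x))) = t *\<^sub>R q x - q (q x)" for x
        by (simp add: g r gr[symmetric] bopD[OF symm_bop[OF sq]])
      ultimately show ?thesis by simp
    qed
    ultimately have "npos (\<lambda>x. (t\<^sup>2 *\<^sub>R x - w x) + (t *\<^sub>R q x - q (q x)))"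
      by (rule npos_plus)
    moreover have "(t\<^sup>2 *\<^sub>R x - w x) + (t *\<^sub>R q x - q (q x)) = t\<^sup>2 *\<^sub>R x - 2 *\<^sub>R q (q x)" for x
      by (simp add: w_def scaleR_2 algebra_simps)
    ultimately have "npos (\<lambda>x. t\<^sup>2 *\<^sub>R x - 2 *\<^sub>R q (q x))" by simp
    moreover have "npos (\<lambda>x. 2 *\<^sub>R q (q x))"
      by (rule npos_scaled[of "\<lambda>x. q (q x)"]) (auto intro: npos_square sq)
    ultimately have "nrm (2 *\<^sub>R q (q x)) \<le> t\<^sup>2 * nrm x" for x
      by (intro npos_norm_le) auto
    from this[unfolded nrm_scaleR] have qq: "nrm (q (q x)) \<le> (t\<^sup>2 / 2) * nrm x" for x
      by (simp add: mult.commute)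
    have qt: "nrm (q x) \<le> (t / sqrt 2) * nrm x" for x
    proof (rule power2_le_imp_le)
      have "(nrm (q x))\<^sup>2 \<le> nrm x * ((t\<^sup>2 / 2) * nrm x)"
        unfolding symm_nrm_power2[OF sq] by (intro order_trans[OF ip_Cauchy_Schwarz] mult_left_mono qq) simp
      then show "(nrm (q x))\<^sup>2 \<le> ((t / sqrt 2) * nrm x)\<^sup>2"
        by (simp add: power_mult_distrib power_divide power2_eq_square algebra_simps)
    qed (use \<open>t \<ge> 0\<close> in auto)
    \<comment> \<open>The squared norm of c' x is the norm of <x, q x>, so the gain for
      \<open>q\<close> passes to \<open>c'\<close> and then to its adjoint \<open>c\<close>.\<close>
    have "nrm (c' x) \<le> sqrt (t / sqrt 2) * nrm x" for x
    proof (rule power2_le_imp_le)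
      have "(nrm (c' x))\<^sup>2 = norm (ip x (q x))" by (simp add: nrm_power2 q_def adj')
      also have "\<dots> \<le> nrm x * ((t / sqrt 2) * nrm x)"
        by (intro order_trans[OF ip_Cauchy_Schwarz] mult_left_mono qt) simp
      finally show "(nrm (c' x))\<^sup>2 \<le> (sqrt (t / sqrt 2) * nrm x)\<^sup>2"
        using \<open>t \<ge> 0\<close> by (simp add: power_mult_distrib) (simp add: power2_eq_square algebra_simps)
    qed (use \<open>t \<ge> 0\<close> in auto)
    then have "nrm (c x) \<le> sqrt (t / sqrt 2) * nrm x"
      by (rule adjoint_bop_bound[OF adj'])
    then have "(nrm (c x))\<^sup>2 \<le> (sqrt (t / sqrt 2) * nrm x)\<^sup>2" by (intro power_mono) auto
    then show ?thesis using \<open>t \<ge> 0\<close> by (simp add: power_mult_distrib)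
  qed
  obtain k where k: "k > 0" "\<And>x. nrm (c x) \<le> k * nrm x" using bop_bound[OF c] by blast
  \<comment> \<open>Any bound k of \<open>c\<close> starts the iteration; each pass gains a factor 1
    / sqrt 2.\<close>
  have "(nrm (c x))\<^sup>2 \<le> (k\<^sup>2 * (1 / sqrt 2) ^ n) * (nrm x)\<^sup>2" for n x
  proof (induction n arbitrary: x)
    case 0
    show ?case using power_mono[OF k(2)[of x], of 2] by (simp add: power_mult_distrib)
  next
    case (Suc n)
    show ?case using step[of "k\<^sup>2 * (1 / sqrt 2) ^ n" x] Suc by (simp add: algebra_simps)
  qed
  moreover have "(\<lambda>n. (k\<^sup>2 * (1 / sqrt 2) ^ n) * (nrm x)\<^sup>2) \<longlonglongrightarrow> (k\<^sup>2 * 0) * (nrm x)\<^sup>2"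
    by (intro tendsto_intros LIMSEQ_power_zero) simp
  ultimately have "(nrm (c x))\<^sup>2 \<le> 0"
    by (intro LIMSEQ_le_const[of _ 0]) auto
  then show ?thesis by simp
qed

text \<open>Let N be the negative part of T = b' b and c = b N. Then c' c = N T N = - N^3, and N^3
  is the square of the symmetric operator D N. Hence b N = 0 and N^2 = - T N = 0.\<close>

lemma npos_adjoint_times_self:
  assumes b: "bop b" and b': "bop b'" and adj: "\<And>x y. ip (b x) y = ip x (b' y)"
  shows "npos (\<lambda>x. b' (b x))"
proof -
  have adj': "ip (b' x) y = ip x (b y)" for x y by (metis adj ip_star)
  have T: "symm (\<lambda>x. b' (b x))" unfolding symm_def using bop_comp[OF b' b] by (auto simp: adj adj')
  obtain D N where D: "symm D" and N: "symm N" and DT: "\<And>x. D (D x) - b' (b x) = 2 *\<^sub>R N x"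
    and DN: "\<And>x. D (D (N x)) = N (N x)" "\<And>x. b' (b (N x)) = - N (N x)"
      "\<And>x. N (b' (b x)) = b' (b (N x))" "\<And>x. N (D x) = D (N x)"
    by (rule symm_negative_part[OF T]) (rule that)
  note lN = bopD[OF symm_bop[OF N]]
  have sDN: "symm (\<lambda>x. D (N x))" using symm_comp[OF D N] DN(4) by simp
  have bN: "b (N x) = 0" for x
  proof (rule adjoint_times_self_not_negative[of "\<lambda>x. b (N x)" "\<lambda>x. N (b' x)", OF _ _ _ sDN])
    show "bop (\<lambda>x. b (N x))" "bop (\<lambda>x. N (b' x))" using bop_comp[OF b symm_bop[OF N]] bop_comp[OF symm_bop[OF N] b'] by auto
    show "ip (b (N x)) y = ip x (N (b' y))" for x y by (simp add: adj symm_ip[OF N])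
    show "N (b' (b (N x))) = - D (N (D (N x)))" for x by (simp add: DN lN)
  qed
  have "N (N x) = 0" for x using DN(2)[of x] bN[of x] by (simp add: bopD[OF b'])
  then have "D (D x) = b' (b x)" for x
    by (rule square_if_negative_part_zero[OF D N DT DN(1)])
  then show ?thesis using npos_square[OF D] by simp
qed

end

section \<open>Positive elements of a C*-algebra and Hilbert modules\<close>

text \<open>Here Cauchy-Schwarz is immediate: it is submultiplicativity together with the isometry
  of \<open>star\<close>.\<close>

interpretation alg: ip_space "\<lambda>x y :: 'a::cstar_algebra. star x * y"
  rewrites "hm_norm (\<lambda>x y :: 'a. star x * y) = norm"
proof -
  have norm_eq: "hm_norm (\<lambda>x y :: 'a. star x * y) = norm"
    by (rule ext) (simp add: hm_norm_def cstar_identity)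
  then show "hm_norm (\<lambda>x y :: 'a. star x * y) = norm" .
  show "ip_space (\<lambda>x y :: 'a. star x * y)"
  proof (unfold_locales, unfold norm_eq)
    fix X :: "nat \<Rightarrow> 'a"
    assume "\<And>e. e > 0 \<Longrightarrow> \<exists>N. \<forall>m\<ge>N. \<forall>n\<ge>N. norm (X m - X n) < e"
    then have "Cauchy X" by (simp add: Cauchy_def dist_norm)
    then obtain l where "X \<longlonglongrightarrow> l" using Cauchy_convergent convergent_def by blast
    then show "\<exists>l. (\<lambda>n. norm (X n - l)) \<longlonglongrightarrow> 0"
      using tendsto_norm_zero[OF LIM_zero] by blast
  next
    fix x y :: 'a
    show "norm (star x * y) \<le> norm x * norm y" using norm_mult_ineq[of "star x" y] by simp
  next
    fix x :: 'a
    assume "star x * x = 0"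
    then show "x = 0" using cstar_identity[of x] by simp
  qed (simp_all add: mult_scaleC_right star_mult star_star distrib_left)
qed

text \<open>Left multiplication makes the identity operator available without a unit, and
  \<open>npos\<close> gives closure under sums, which the form star b * b does not show.\<close>

definition positive_elem :: "'a::cstar_algebra \<Rightarrow> bool" where
  "positive_elem a \<longleftrightarrow> alg.npos ((*) a)"

lemma positive_elemI: "alg.npos T \<Longrightarrow> (\<And>x. T x = a * x) \<Longrightarrow> positive_elem a"
  unfolding positive_elem_def by (metis (full_types) ext)

lemma bop_mult: "alg.bop ((*) (a :: 'a::cstar_algebra))"
  unfolding alg.bop_def
  by (auto simp: distrib_left mult_scaleC_right intro!: exI[of _ "norm a"] norm_mult_ineq)

lemma symm_mult: "star a = a \<Longrightarrow> alg.symm ((*) (a :: 'a::cstar_algebra))"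
  unfolding alg.symm_def by (simp add: bop_mult star_mult mult.assoc)

lemma positive_elem_star_mult: "positive_elem (star b * (b :: 'a::cstar_algebra))"
proof -
  have "alg.npos (\<lambda>x. star b * (b * x))"
    by (rule alg.npos_adjoint_times_self) (auto simp: bop_mult star_mult mult.assoc)
  then show ?thesis by (rule positive_elemI) (simp add: mult.assoc)
qed

lemma cstar_positive_imp_positive_elem: "cstar_positive a \<Longrightarrow> positive_elem a"
  by (auto simp: cstar_positive_def positive_elem_star_mult)

lemma positive_elem_add: "positive_elem a \<Longrightarrow> positive_elem b \<Longrightarrow> positive_elem (a + b)"
  unfolding positive_elem_def[of a] positive_elem_def[of b]
  by (rule positive_elemI[OF alg.npos_plus]) (simp_all add: distrib_right)

lemma positive_elem_scaleR: "positive_elem a \<Longrightarrow> r \<ge> 0 \<Longrightarrow> positive_elem (r *\<^sub>R a)"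
  unfolding positive_elem_def[of a] by (rule positive_elemI[OF alg.npos_scaled]) simp_all

lemma positive_elem_zero: "positive_elem 0"
  using positive_elem_star_mult[of 0] by simp

text \<open>Adding b - a to the positive operator \<open>norm b\<close> - b shows that a is at most
  \<open>norm b\<close>, as operators; \<open>npos_norm_le\<close> converts this into a norm
  bound.\<close>

lemma norm_mono_positive_elem:
  fixes a b :: "'a::cstar_algebra"
  assumes a: "positive_elem a" and ab: "positive_elem (b - a)"
  shows "norm a \<le> norm b"
proof -
  have "positive_elem b" using positive_elem_add[OF a ab] by simp
  then have "alg.symm ((*) b)" unfolding positive_elem_def by (rule alg.npos_symm)
  then have "alg.npos (\<lambda>x. norm b *\<^sub>R x - b * x)"
    unfolding alg.npos_def
    by (intro conjI exI[of _ "norm b"] alg.symm_intros) (auto intro: norm_mult_ineq)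
  from alg.npos_plus[OF this ab[unfolded positive_elem_def]]
  have "alg.npos (\<lambda>x. norm b *\<^sub>R x - a * x)" by (simp add: algebra_simps)
  \<comment> \<open>Evaluating at \<open>star a\<close> recovers the norm of a from its left
    multiplication even without a unit.\<close>
  from alg.npos_norm_le[OF a[unfolded positive_elem_def] this, of "star a"]
  have "norm (a * star a) \<le> norm b * norm (star a)" by simp
  moreover have "norm (a * star a) = (norm a)\<^sup>2"
    using cstar_identity[of "star a"] by (simp add: star_star)
  ultimately show ?thesis by (cases "a = 0") (auto simp: power2_eq_square)
qed

lemma positive_elem_antisym:
  assumes "positive_elem a" "positive_elem (- a)" shows "a = 0"
  using norm_mono_positive_elem[of a 0] assms by simp

text \<open>This conjugates k - c, which is no element of the algebra unless there is a unit. The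
  root of 1 - c / k is therefore taken as an operator \<open>R\<close>, whose value R p lies in the
  algebra.\<close>

lemma positive_elem_conj_bound:
  fixes c p :: "'a::cstar_algebra"
  assumes c: "star c = c" and k: "norm c \<le> k" "k > 0"
  shows "positive_elem (k *\<^sub>R (star p * p) - star p * (c * p))"
proof -
  define S where "S = (\<lambda>x. (1/k) *\<^sub>R (c * x))"
  have "alg.symm S" unfolding S_def by (intro alg.symm_scaled symm_mult c)
  moreover have "norm (S x) \<le> norm x" for x
  proof -
    have "norm (c * x) \<le> k * norm x"
      by (rule order_trans[OF norm_mult_ineq mult_right_mono]) (use k in auto)
    then show ?thesis using k(2) by (simp add: S_def field_simps)
  qed
  ultimately obtain R where R: "alg.symm R" "\<And>x. R (R x) = x - S x"
    using alg.symm_sqrt by metis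
  have "star (R p) * R p = star p * R (R p)" by (rule alg.symm_ip[OF R(1)])
  also have "\<dots> = star p * p - (1/k) *\<^sub>R (star p * (c * p))"
    by (simp add: R(2) S_def right_diff_distrib)
  finally have "k *\<^sub>R (star (R p) * R p) = k *\<^sub>R (star p * p) - star p * (c * p)"
    using k(2) by (simp add: scaleR_diff_right)
  then show ?thesis
    using positive_elem_scaleR[OF positive_elem_star_mult, of k "R p"] k(2) by simp
qed

context hilbert_module
begin

lemma ip_act_left: "ip (act x a) y = star a * ip x y"
  by (metis ip_act_right ip_star star_mult)

lemma positive_elem_ip: "positive_elem (ip x x)"
  by (rule cstar_positive_imp_positive_elem[OF ip_positive])

text \<open>Expand the form at z = y - x <x, y> / k. Here k lies slightly above the norm of <x, x>
  so as to be positive even for <x, x> = 0, whence the epsilon.\<close>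

lemma Cauchy_Schwarz_power2: "(norm (ip x y))\<^sup>2 \<le> norm (ip x x) * norm (ip y y)"
proof (rule field_le_epsilon)
  fix e :: real assume "e > 0"
  define d where "d = e / (norm (ip y y) + 1)"
  define k where "k = norm (ip x x) + d"
  have "d > 0" using \<open>e > 0\<close> by (simp add: d_def add_nonneg_pos)
  then have k: "norm (ip x x) \<le> k" "k > 0" by (auto simp: k_def add_nonneg_pos)
  define p where "p = ip x y"
  define s where "s = 1 / k"
  have "s > 0" using k by (simp add: s_def)
  define z where "z = y + scaleC (complex_of_real (- s)) (act x p)"
  have left: "ip (u + v) w = ip u w + ip v w" "ip (scaleC (complex_of_real r) u) w = r *\<^sub>R ip u w" for u v w r
  proof -
    show "ip (u + v) w = ip u w + ip v w" by (metis ip_add_right ip_star star_add)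
    have "star (ip w (scaleC (complex_of_real r) u)) = star (r *\<^sub>R ip w u)"
      by (simp only: ip_scaleC_right scaleR_scaleC)
    then show "ip (scaleC (complex_of_real r) u) w = r *\<^sub>R ip u w"
      by (simp only: star_scaleR ip_star)
  qed
  have right: "ip w (scaleC (complex_of_real r) u) = r *\<^sub>R ip w u" for w u r
    by (simp only: ip_scaleC_right scaleR_scaleC)
  have yx: "ip y x = star p" by (simp add: p_def ip_star)
  have two: "(2 * s) *\<^sub>R (star p * p) = s *\<^sub>R (star p * p) + s *\<^sub>R (star p * p)"
    by (simp add: scaleR_add_left[symmetric])
  have "ip z z = ip y y + (- s) *\<^sub>R (star p * p) + (- s) *\<^sub>R (star p * p)
      + (- s * - s) *\<^sub>R (star p * (ip x x * p))"
    unfolding z_def left right ip_add_right ip_act_left ip_act_right yx p_def[symmetric]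
    by (simp add: algebra_simps)
  then have zz: "ip z z = ip y y - (2 * s) *\<^sub>R (star p * p) + (s * s) *\<^sub>R (star p * (ip x x * p))"
    by (simp add: two)
  \<comment> \<open>The added positive term replaces the conjugate of <x, x> by k star p * p; since
    s k = 1, only <y, y> - s star p * p remains.\<close>
  have "positive_elem (ip z z + (s * s) *\<^sub>R (k *\<^sub>R (star p * p) - star p * (ip x x * p)))"
    using \<open>s > 0\<close> k
    by (intro positive_elem_add positive_elem_scaleR positive_elem_ip positive_elem_conj_bound ip_star) auto
  moreover have "ip z z + (s * s) *\<^sub>R (k *\<^sub>R (star p * p) - star p * (ip x x * p))
      = ip y y - s *\<^sub>R (star p * p)"
  proof -
    have "(s * s) *\<^sub>R (k *\<^sub>R (star p * p)) = s *\<^sub>R (star p * p)" using k(2) by (simp add: s_def)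
    then show ?thesis unfolding zz scaleR_diff_right two by simp
  qed
  ultimately have "norm (s *\<^sub>R (star p * p)) \<le> norm (ip y y)"
    using \<open>s > 0\<close> by (intro norm_mono_positive_elem positive_elem_scaleR positive_elem_star_mult) auto
  then have "s * (norm p)\<^sup>2 \<le> norm (ip y y)" using \<open>s > 0\<close> by (simp add: cstar_identity)
  then have "(norm p)\<^sup>2 \<le> k * norm (ip y y)" using k(2) by (simp add: s_def field_simps)
  also have "\<dots> = norm (ip x x) * norm (ip y y) + d * norm (ip y y)"
    by (simp add: k_def algebra_simps)
  also have "d * norm (ip y y) \<le> d * (norm (ip y y) + 1)" using \<open>d > 0\<close> by simp
  also have "\<dots> = e" unfolding d_def using norm_ge_zero[of "ip y y"] by (simp add: add_nonneg_eq_0_iff)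
  finally show "(norm (ip x y))\<^sup>2 \<le> norm (ip x x) * norm (ip y y) + e" by (simp add: p_def)
qed

lemma ip_space_axiom: "ip_space ip"
proof
  show "norm (ip x y) \<le> hm_norm ip x * hm_norm ip y" for x y
    using real_sqrt_le_mono[OF Cauchy_Schwarz_power2[of x y]] by (simp add: hm_norm_def real_sqrt_mult)
qed (auto intro: ip_add_right ip_scaleC_right ip_star ip_definite complete)

end

sublocale hilbert_module \<subseteq> hs: ip_space ip
  by (rule ip_space_axiom)

section \<open>Automatic boundedness of adjointable maps, and extension from dense parts\<close>

context ip_space
begin

lemma tends_imp_Cauchy:
  assumes "tends X l" "e > 0"
  shows "\<exists>N. \<forall>m\<ge>N. \<forall>n\<ge>N. nrm (X m - X n) < e"
proof -
  obtain N where N: "\<And>n. n \<ge> N \<Longrightarrow> nrm (X n - l) < e / 2"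
    using assms LIMSEQ_D[of "\<lambda>n. nrm (X n - l)" 0 "e / 2"] by (auto simp: tends_def)
  have "nrm (X m - X n) < e" if "m \<ge> N" "n \<ge> N" for m n
    using nrm_triangle_mid[of "X m" "X n" l] N[OF that(1)] N[OF that(2)] nrm_minus_commute[of l "X n"] by simp
  then show ?thesis by blast
qed

lemma adjoint_pair_linear:
  assumes adj: "\<And>x y. ip (T x) y = ip x (T' y)"
  shows "T (x + y) = T x + T y" and "T (scaleC c x) = scaleC c (T x)"
proof -
  have "ip z (T u) = ip (T' z) u" for z u by (metis adj ip_star)
  then show "T (x + y) = T x + T y" and "T (scaleC c x) = scaleC c (T x)"
    by (auto intro!: ip_eqI simp: ip_add_right ip_scaleC_right)
qed

text \<open>Gives access to Baire category although the type carries no metric.\<close>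

lemma Metric_space_nrm: "Metric_space UNIV (\<lambda>x y. nrm (x - y))"
proof
  show "nrm (x - y) = nrm (y - x)" for x y by (rule nrm_minus_commute)
  show "nrm (x - z) \<le> nrm (x - y) + nrm (y - z)" for x y z by (rule nrm_triangle_mid)
  show "0 \<le> nrm (x - y)" for x y by simp
  show "nrm (x - y) = 0 \<longleftrightarrow> x = y" for x y by simp
qed

text \<open>The sets where T has norm at most n cover a complete space and are closed because of the
  adjoint. By Baire category one of them contains a ball, and linearity moves it to the
  origin.\<close>

lemma adjoint_pair_bop:
  assumes adj: "\<And>x y. ip (T x) y = ip x (T' y)"
  shows "bop T"
proof -
  note add = adjoint_pair_linear(1)[of T T', OF adj] and scal = adjoint_pair_linear(2)[of T T', OF adj]
  have scalR: "T (r *\<^sub>R x) = r *\<^sub>R T x" for r x by (simp add: scaleR_scaleC scal)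
  have diff: "T (x - y) = T x - T y" for x y
    using add[of x "-1 *\<^sub>R y"] unfolding scalR by simp
  have T0: "T 0 = 0" using scalR[of 0 0] by simp
  interpret M: Metric_space UNIV "\<lambda>x y. nrm (x - y)"
    by (rule Metric_space_nrm)
  have complete': "M.mcomplete"
    unfolding M.mcomplete_def
  proof (intro allI impI)
    fix X assume "M.MCauchy X"
    then have "\<forall>e>0. \<exists>N. \<forall>m n. N \<le> m \<longrightarrow> N \<le> n \<longrightarrow> nrm (X m - X n) < e"
      unfolding M.MCauchy_def by (rule conjunct2)
    then have "\<exists>N. \<forall>m\<ge>N. \<forall>n\<ge>N. nrm (X m - X n) < e" if "e > 0" for e
      using that by fast
    from complete[OF this] obtain l where "(\<lambda>n. nrm (X n - l)) \<longlonglongrightarrow> 0" by blast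
    then have "limitin M.mtopology X l sequentially"
      unfolding M.limitin_metric eventually_sequentially using LIMSEQ_D by fastforce
    then show "\<exists>x. limitin M.mtopology X x sequentially" by blast
  qed
  define B where "B = (\<lambda>n::nat. {x. nrm (T x) \<le> real n})"
  have closed: "closedin M.mtopology (B n)" for n
    unfolding M.closedin_metric
  proof (intro conjI allI impI)
    fix x assume "x \<in> UNIV - B n"
    then have gt: "nrm (T x) > real n" by (simp add: B_def)
    define y where "y = T x"
    have "nrm y > 0" using gt y_def by simp
    \<comment> \<open>Lower semicontinuity: \<open>nrm (T v)\<close> is at least \<open>norm (ip v (T' y)) / nrm y\<close>, which is
      continuous in \<open>v\<close>.\<close>
    define r where "r = (nrm y - real n) * nrm y / (nrm (T' y) + 1)"
    have "r > 0" using gt \<open>nrm y > 0\<close> by (simp add: r_def y_def add_nonneg_pos)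
    moreover have "disjnt (B n) (M.mball x r)"
    proof (rule ccontr)
      assume "\<not> disjnt (B n) (M.mball x r)"
      then obtain v where v: "nrm (T v) \<le> real n" "nrm (x - v) < r"
        by (auto simp: disjnt_def B_def)
      have "(nrm y)\<^sup>2 = norm (ip (T v) y + ip (T (x - v)) y)"
        by (simp add: nrm_power2 diff ip_diff_left y_def)
      also have "\<dots> \<le> norm (ip (T v) y) + norm (ip (x - v) (T' y))"
        using norm_triangle_ineq[of "ip (T v) y" "ip (T (x - v)) y"] by (simp add: adj)
      also have "\<dots> \<le> real n * nrm y + r * nrm (T' y)"
        using v by (intro add_mono order_trans[OF ip_Cauchy_Schwarz] mult_right_mono) auto
      also have "\<dots> < real n * nrm y + r * (nrm (T' y) + 1)" using \<open>r > 0\<close> by simp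
      also have "\<dots> = (nrm y)\<^sup>2"
      proof -
        have "nrm (T' y) + 1 \<noteq> 0" using nrm_ge_0[of "T' y"] by linarith
        then have "r * (nrm (T' y) + 1) = (nrm y - real n) * nrm y" by (simp add: r_def)
        then show ?thesis by (simp add: power2_eq_square algebra_simps)
      qed
      finally show False by simp
    qed
    ultimately show "\<exists>r>0. disjnt (B n) (M.mball x r)" by blast
  qed simp
  have "\<exists>n. M.mtopology interior_of (B n) \<noteq> {}"
  proof (rule ccontr)
    assume "\<not> ?thesis"
    then have "M.mtopology interior_of \<Union>(range B) = {}"
      using closed by (intro M.metric_Baire_category_alt complete') auto
    moreover have "\<Union>(range B) = topspace M.mtopology"
      using real_arch_simple by (auto simp: B_def)
    ultimately show False using interior_of_topspace[of M.mtopology] by simp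
  qed
  then obtain n x e where "e > 0" and e: "M.mball x e \<subseteq> B n"
    by (auto simp: M.in_interior_of_mball ex_in_conv[symmetric] simp del: ex_in_conv)
  \<comment> \<open>T v is the difference of two values of T on the ball around x.\<close>
  have small: "nrm (T v) \<le> 2 * real n" if "nrm v < e" for v
  proof -
    have "x + v \<in> B n" "x \<in> B n" using e that \<open>e > 0\<close> by auto
    then show ?thesis
      using nrm_triangle_diff[of "T (x + v)" "T x"] by (simp add: B_def add)
  qed
  have "nrm (T v) \<le> (4 * real n / e) * nrm v" for v
  proof (cases "v = 0")
    case True
    then show ?thesis by (simp add: T0)
  next
    case False
    then have "nrm v > 0" using nrm_ge_0[of v] nrm_eq_0[of v] by linarith
    define r where "r = e / (2 * nrm v)"
    have "r > 0" using \<open>e > 0\<close> \<open>nrm v > 0\<close> by (simp add: r_def)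
    have "nrm (r *\<^sub>R v) < e" using \<open>e > 0\<close> \<open>nrm v > 0\<close> by (simp add: nrm_scaleR r_def)
    from small[OF this] have "r * nrm (T v) \<le> 2 * real n" using \<open>r > 0\<close> by (simp add: scalR nrm_scaleR)
    then show ?thesis using \<open>e > 0\<close> \<open>nrm v > 0\<close> by (simp add: r_def field_simps)
  qed
  then show ?thesis unfolding bop_def using add scal by blast
qed

lemma symmI: "(\<And>x y. ip (T x) y = ip x (T y)) \<Longrightarrow> symm T"
  unfolding symm_def using adjoint_pair_bop by blast

end

text \<open>The bound makes the assignment of J u to I u well defined and Lipschitz. Describing
  \<open>W\<close> by all approximating sequences lets linearity and estimates pass to the limit
  with any convenient choice.\<close>

lemma continuous_extension:
  fixes I :: "'i \<Rightarrow> 'f::complex_vector" and J :: "'i \<Rightarrow> 'g::complex_vector"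
    and ipF :: "'f \<Rightarrow> 'f \<Rightarrow> 'a::cstar_algebra" and ipG :: "'g \<Rightarrow> 'g \<Rightarrow> 'a"
  assumes "ip_space ipF" "ip_space ipG"
    and dense: "\<And>y e. e > 0 \<Longrightarrow> \<exists>u\<in>A. hm_norm ipF (y - I u) < e"
    and bound: "\<And>u v. u \<in> A \<Longrightarrow> v \<in> A \<Longrightarrow> hm_norm ipG (J u - J v) \<le> c * hm_norm ipF (I u - I v)"
  obtains W where "\<And>y. \<exists>U. range U \<subseteq> A \<and> ip_space.tends ipF (\<lambda>n. I (U n)) y"
    and "\<And>y U. range U \<subseteq> A \<Longrightarrow> ip_space.tends ipF (\<lambda>n. I (U n)) y \<Longrightarrow> ip_space.tends ipG (\<lambda>n. J (U n)) (W y)"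
proof -
  interpret F: ip_space ipF by fact
  interpret G: ip_space ipG by fact
  define k where "k = \<bar>c\<bar> + 1"
  have "k > 0" by (simp add: k_def)
  have bd: "G.nrm (J u - J v) \<le> k * F.nrm (I u - I v)" if "u \<in> A" "v \<in> A" for u v
    by (rule order_trans[OF bound[OF that] mult_right_mono]) (auto simp: k_def)
  have ex: "\<exists>U. range U \<subseteq> A \<and> F.tends (\<lambda>n. I (U n)) y" for y
  proof -
    have "\<forall>n. \<exists>u\<in>A. F.nrm (y - I u) < 1 / real (Suc n)"
      using dense by simp
    then obtain U where U: "\<And>n. U n \<in> A" "\<And>n. F.nrm (y - I (U n)) < 1 / real (Suc n)" by metis
    have "F.tends (\<lambda>n. I (U n)) y"
    proof (rule F.tends_comparison)
      show "F.nrm (I (U n) - y) \<le> 1 / real (Suc n)" for n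
        using U(2)[of n] by (simp add: F.nrm_minus_commute)
      show "(\<lambda>n. 1 / real (Suc n)) \<longlonglongrightarrow> 0"
        using LIMSEQ_inverse_real_of_nat by (simp add: inverse_eq_divide)
    qed
    then show ?thesis using U by blast
  qed
  then obtain U where U: "\<And>y. range (U y) \<subseteq> A" "\<And>y. F.tends (\<lambda>n. I (U y n)) y" by metis
  have "\<exists>l. G.tends (\<lambda>n. J (U y n)) l" for y
    unfolding G.tends_def
  proof (rule G.complete)
    fix e :: real assume "e > 0"
    then obtain N where N: "\<And>m n. m \<ge> N \<Longrightarrow> n \<ge> N \<Longrightarrow> F.nrm (I (U y m) - I (U y n)) < e / k"
      using F.tends_imp_Cauchy[OF U(2)[of y], of "e / k"] \<open>k > 0\<close> by auto
    have "G.nrm (J (U y m) - J (U y n)) < e" if "m \<ge> N" "n \<ge> N" for m n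
    proof (rule order_le_less_trans[OF bd])
      show "k * F.nrm (I (U y m) - I (U y n)) < e" using N[OF that] \<open>k > 0\<close> by (simp add: field_simps)
    qed (use U(1)[of y] in auto)
    then show "\<exists>N. \<forall>m\<ge>N. \<forall>n\<ge>N. G.nrm (J (U y m) - J (U y n)) < e" by blast
  qed
  then obtain W where W: "\<And>y. G.tends (\<lambda>n. J (U y n)) (W y)" by metis
  have "G.tends (\<lambda>n. J (X n)) (W y)" if X: "range X \<subseteq> A" "F.tends (\<lambda>n. I (X n)) y" for X y
  proof (rule G.tends_comparison)
    let ?f = "\<lambda>n. k * (F.nrm (I (X n) - y) + F.nrm (I (U y n) - y)) + G.nrm (J (U y n) - W y)"
    have "?f \<longlonglongrightarrow> k * (0 + 0) + 0"
      using X(2) U(2)[of y] W[of y] unfolding F.tends_def G.tends_def by (intro tendsto_intros)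
    then show "?f \<longlonglongrightarrow> 0" by simp
    show "G.nrm (J (X n) - W y) \<le> ?f n" for n
    proof -
      have "G.nrm (J (X n) - J (U y n)) \<le> k * F.nrm (I (X n) - I (U y n))"
        using X(1) U(1)[of y] by (intro bd) auto
      also have "\<dots> \<le> k * (F.nrm (I (X n) - y) + F.nrm (I (U y n) - y))"
        using F.nrm_triangle_mid[of "I (X n)" "I (U y n)" y] F.nrm_minus_commute[of y "I (U y n)"] \<open>k > 0\<close>
        by (intro mult_left_mono) auto
      finally show ?thesis using G.nrm_triangle_mid[of "J (X n)" "W y" "J (U y n)"] by simp
    qed
  qed
  with ex show thesis by (rule that)
qed

context hilbert_module
begin

text \<open>At N x the form of T equals - <D N x, D N x>. Being positive as well, it vanishes, so D
  N x = 0 and N^2 x = D^2 N x = 0.\<close>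

lemma square_if_form_positive:
  assumes T: "hs.symm T" and pos: "\<And>x. positive_elem (ip x (T x))"
  obtains D where "hs.symm D" "\<And>x. D (D x) = T x"
proof -
  obtain D N where D: "hs.symm D" and N: "hs.symm N" and DT: "\<And>x. D (D x) - T x = 2 *\<^sub>R N x"
    and DN: "\<And>x. D (D (N x)) = N (N x)" "\<And>x. T (N x) = - N (N x)"
      "\<And>x. N (T x) = T (N x)" "\<And>x. N (D x) = D (N x)"
    by (rule hs.symm_negative_part[OF T]) (rule that)
  have "N (N x) = 0" for x
  proof -
    have "ip (N x) (T (N x)) = - ip (D (N x)) (D (N x))"
      by (simp add: DN(2) hs.symm_ip[OF D] hs.ip_minus_right flip: DN(1))
    then have "ip (D (N x)) (D (N x)) = 0"
      using pos[of "N x"] positive_elem_ip[of "D (N x)"] by (intro positive_elem_antisym) auto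
    then show ?thesis
      using DN(1)[of x] hs.bop_zero[OF hs.symm_bop[OF D]] ip_definite by metis
  qed
  then have "D (D x) = T x" for x
    by (rule hs.square_if_negative_part_zero[OF D N DT DN(1)])
  with D show thesis by (rule that)
qed

end

section \<open>Kernels and Kolmogorov decompositions\<close>

lemma hm_adjoint_ip:
  assumes "T \<in> adjointables ipE ipF"
  shows "ipF (T x) y = ipE x (hm_adjoint ipE ipF T y)"
proof -
  have "\<exists>T'. hm_is_adjoint ipE ipF T T'" using assms by (simp add: adjointables_def)
  then have "hm_is_adjoint ipE ipF T (hm_adjoint ipE ipF T)"
    unfolding hm_adjoint_def by (rule someI_ex)
  then show ?thesis by (simp add: hm_is_adjoint_def)
qed

lemma adjointablesI: "(\<And>x y. ipF (T x) y = ipE x (T' y)) \<Longrightarrow> T \<in> adjointables ipE ipF"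
  by (auto simp: adjointables_def hm_is_adjoint_def)

context ip_space
begin

lemma hm_adjoint_eq:
  assumes "\<And>x y. ipF (T x) y = ip x (T' y)" shows "hm_adjoint ip ipF T = T'"
proof (rule ext, rule ip_eqI)
  fix y x show "ip x (hm_adjoint ip ipF T y) = ip x (T' y)"
    using hm_adjoint_ip[OF adjointablesI[of ipF T ip T', OF assms]] assms by metis
qed

text \<open>Kept general in \<open>L\<close>, since it serves for the kernel V(s)' C' C V(t) and for
  differences of two such \<open>L\<close> too.\<close>

lemma sum_centered_kernel:
  assumes "finite J" and adj: "\<And>s t x y. ip (L s t x) y = ip x (L t s y)"
    and K: "\<And>s t x. K s t x = 2 *\<^sub>R L s t x - L s s x - L t t x"
    and u: "(\<Sum>i\<in>J. u i) = 0"
  shows "(\<Sum>i\<in>J. \<Sum>j\<in>J. ip (u i) (K (p i) (p j) (u j))) =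
    2 *\<^sub>R (\<Sum>i\<in>J. \<Sum>j\<in>J. ip (u i) (L (p i) (p j) (u j)))"
proof -
  have diag: "L s s (\<Sum>j\<in>J. u j) = (\<Sum>j\<in>J. L s s (u j))" for s
  proof (rule ip_eqI)
    fix z show "ip z (L s s (\<Sum>j\<in>J. u j)) = ip z (\<Sum>j\<in>J. L s s (u j))"
      by (simp add: ip_sum_right flip: adj)
  qed
  have L0: "L s s 0 = 0" for s by (rule ip_eqI) (simp flip: adj)
  have "(\<Sum>j\<in>J. ip (u i) (L (p i) (p i) (u j))) = 0" for i
    by (simp add: ip_sum_right[symmetric] diag[symmetric] u L0)
  moreover have "(\<Sum>i\<in>J. \<Sum>j\<in>J. ip (u i) (L (p j) (p j) (u j))) = 0"
    by (subst sum.swap) (simp add: ip_sum_left[symmetric] u)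
  ultimately show ?thesis
    by (simp add: K ip_diff_right ip_scaleR_right sum_subtractf scaleR_right.sum)
qed

end

context hilbert_module
begin

lemma adjoint_pair_act:
  assumes "\<And>x y. ip (T x) y = ip x (T' y)" shows "T (act x a) = act (T x) a"
proof (rule hs.ip_eqI)
  fix z
  have "ip z (T w) = ip (T' z) w" for w by (metis assms ip_star)
  then show "ip z (T (act x a)) = ip z (act (T x) a)" by (simp add: ip_act_right)
qed

lemma positive_opI:
  assumes "hs.symm T" "\<And>x. positive_elem (ip x (T x))" shows "positive_op ip T"
proof -
  obtain D where D: "hs.symm D" "\<And>x. D (D x) = T x"
    using square_if_form_positive[OF assms] by metis
  have "hm_adjoint ip ip D = D" by (rule hs.hm_adjoint_eq) (rule hs.symm_ip[OF D(1)])
  moreover have "D \<in> adjointables ip ip" by (rule adjointablesI) (rule hs.symm_ip[OF D(1)])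
  ultimately show ?thesis unfolding positive_op_def using D(2) by (intro bexI[of _ D]) auto
qed

lemma positive_opD:
  assumes "positive_op ip T" shows "positive_elem (ip x (T x))"
proof -
  obtain B where B: "B \<in> adjointables ip ip" "T = hm_adjoint ip ip B \<circ> B"
    using assms by (auto simp: positive_op_def)
  then show ?thesis using positive_elem_ip[of "B x"] by (simp add: hm_adjoint_ip[OF B(1)])
qed

text \<open>Testing the kernel on rank-one operators \<open>x \<mapsto> u\<^sub>i \<langle>y, x\<rangle>\<close> only shows \<open>v\<^sup>* g v \<ge> 0\<close> for
  \<open>v = \<langle>y, x\<rangle>\<close>, where \<open>g\<close> is the element in question. Since \<open>y\<close> can be multiplied by elements of
  the algebra, the negative part of \<open>g\<close> must annihilate all inner products, and \<open>g\<close> is a sum of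
  these.\<close>

lemma cond_pos_def_kernel_form:
  fixes u :: "nat \<Rightarrow> 'e" and p :: "nat \<Rightarrow> 's"
  assumes M: "cond_pos_def_kernel ip M" and "n \<ge> 2" and u: "(\<Sum>i<n. u i) = 0"
  shows "positive_elem (\<Sum>i<n. \<Sum>j<n. ip (u i) (M (p i) (p j) (u j)))"
proof -
  have herm: "M s t \<in> adjointables ip ip" "hm_adjoint ip ip (M t s) = M s t" for s t
    using M by (auto simp: cond_pos_def_kernel_def hermitian_kernel_def)
  have adj: "ip (M s t x) y = ip x (M t s y)" for s t x y
    using hm_adjoint_ip[OF herm(1)] herm(2) by metis
  define g where "g = (\<Sum>i<n. \<Sum>j<n. ip (u i) (M (p i) (p j) (u j)))"
  have rank_one: "positive_elem (star (ip y z) * (g * ip y z))" for y z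
  proof -
    define b where "b = (\<lambda>i x. act (u i) (ip y x))"
    have b_adj: "ip (b i x) w = ip x (act y (ip (u i) w))" for i x w
      by (simp add: b_def ip_act_left ip_act_right ip_star)
    then have b: "b i \<in> adjointables ip ip" for i by (rule adjointablesI)
    have "act 0 a = 0" for a using act_add_left[of 0 0 a] by simp
    moreover have "act (\<Sum>i<m. u i) a = (\<Sum>i<m. act (u i) a)" for m a
      by (induction m) (simp_all add: act_add_left calculation)
    ultimately have "\<forall>x. (\<Sum>i<n. b i x) = 0" by (simp add: b_def flip: u)
    then have "positive_op ip (\<lambda>x. \<Sum>i<n. \<Sum>j<n. hm_adjoint ip ip (b i) (M (p i) (p j) (b j x)))"
      using M \<open>n \<ge> 2\<close> b unfolding cond_pos_def_kernel_def by simp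
    from positive_opD[OF this, of z]
    have "positive_elem (\<Sum>i<n. \<Sum>j<n. ip (b i z) (M (p i) (p j) (b j z)))"
      by (simp add: hs.ip_sum_right flip: hm_adjoint_ip[OF b])
    moreover have "ip (b i z) (M s t (b j z)) = star (ip y z) * (ip (u i) (M s t (u j)) * ip y z)" for i j s t
      by (simp add: b_def adjoint_pair_act[of "M s t" "M t s", OF adj] ip_act_left ip_act_right mult.assoc)
    ultimately show ?thesis
      by (simp add: g_def sum_distrib_left sum_distrib_right)
  qed
  have "star g = g"
  proof -
    have sum_star: "star (\<Sum>i\<in>A. h i) = (\<Sum>i\<in>A. star (h i))" for A :: "nat set" and h :: "nat \<Rightarrow> 'a"
      by (induction A rule: infinite_finite_induct) (auto simp: star_add)
    have "star g = (\<Sum>i<n. \<Sum>j<n. ip (u j) (M (p j) (p i) (u i)))"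
      by (simp add: g_def sum_star ip_star adj)
    also have "\<dots> = g" unfolding g_def by (rule sum.swap)
    finally show ?thesis .
  qed
  then have T: "alg.symm ((*) g)" by (rule symm_mult)
  obtain D N where D: "alg.symm D" and N: "alg.symm N" and DT: "\<And>x. D (D x) - g * x = 2 *\<^sub>R N x"
    and DN: "\<And>x. D (D (N x)) = N (N x)" "\<And>x. g * N x = - N (N x)"
      "\<And>x. N (g * x) = g * N x" "\<And>x. N (D x) = D (N x)"
    by (rule alg.symm_negative_part[OF T]) (rule that)
  note lN = alg.bopD[OF alg.symm_bop[OF N]]
  have N_mult: "N (x * a) = N x * a" for x a
    by (rule alg.ip_eqI) (simp add: mult.assoc[symmetric] flip: alg.symm_ip[OF N])
  have N3: "N (N (N (ip y z))) = 0" for y z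
  proof -
    define w where "w = N (N (ip y z))"
    \<comment> \<open>\<open>N\<close> commutes with right multiplications and with g, so this
      change of y turns the tested element <y, z> into - N^2 <y, z>.\<close>
    have "ip (act y (star (N g))) z = N g * ip y z" by (simp add: ip_act_left star_star)
    also have "\<dots> = - w" by (simp add: w_def DN(2,3) flip: N_mult)
    finally have "ip (act y (star (N g))) z = - w" .
    with rank_one[of "act y (star (N g))" z] have "positive_elem (star (- w) * (g * - w))" by simp
    moreover have "star (- w) = - star w" using star_scaleR[of "-1" w] by simp
    ultimately have "positive_elem (star w * (g * w))" by simp
    \<comment> \<open>w lies in the range of \<open>N\<close>, where g acts as - D^2; so minus a
      square is positive.\<close>
    moreover have "g * w = - D (D w)" by (simp add: w_def DN(1,2))
    ultimately have "positive_elem (- (star (D w) * D w))"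
      by (simp add: alg.symm_ip[OF D])
    with positive_elem_star_mult have "star (D w) * D w = 0" by (rule positive_elem_antisym)
    then have "D w = 0" by (rule alg.ip_definite)
    then show ?thesis using DN(1)[of "N (ip y z)"] by (simp add: w_def alg.bop_zero[OF alg.symm_bop[OF D]])
  qed
  have "N (N (N g)) = 0"
  proof -
    have N_sum: "N (\<Sum>i\<in>A. h i) = (\<Sum>i\<in>A. N (h i))" for A :: "nat set" and h
      by (induction A rule: infinite_finite_induct) (auto simp: lN)
    show ?thesis by (simp add: g_def N_sum N3)
  qed
  \<comment> \<open>Right multiplication carries the vanishing from g to all g * x, and N g = - N^2
    as operators turns it into N^4 = 0.\<close>
  then have "N (N (N (g * x))) = 0" for x by (simp add: N_mult)
  then have "N (N (N (N x))) = 0" for x by (simp add: DN(2,3) lN)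
  then have "N (N (N x)) = 0" for x using alg.symm_square_zero[OF N] by blast
  then have "D (D x) = g * x" for x
    by (rule alg.square_if_negative_part_zero[OF D N DT DN(1)])
  then have "positive_elem g" by (rule positive_elemI[OF alg.npos_square[OF D]])
  then show ?thesis by (simp add: g_def)
qed

lemma nrm_act: "hs.nrm (act x a) \<le> norm a * hs.nrm x"
proof (rule power2_le_imp_le)
  have "(hs.nrm (act x a))\<^sup>2 = norm (star a * (ip x x * a))"
    by (simp add: hs.nrm_power2 ip_act_left ip_act_right mult.assoc)
  also have "\<dots> \<le> norm a * (norm (ip x x) * norm a)"
    using norm_mult_ineq[of "star a" "ip x x * a"] mult_left_mono[OF norm_mult_ineq[of "ip x x" a], of "norm a"]
    by simp
  finally show "(hs.nrm (act x a))\<^sup>2 \<le> (norm a * hs.nrm x)\<^sup>2"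
    by (simp add: hs.nrm_power2 power_mult_distrib) (simp add: power2_eq_square mult_ac)
qed simp

lemma tends_act:
  assumes "hs.tends X l" shows "hs.tends (\<lambda>n. act (X n) a) (act l a)"
proof (rule hs.tends_comparison)
  show "(\<lambda>n. norm a * hs.nrm (X n - l)) \<longlonglongrightarrow> 0"
    using tendsto_mult_left[OF assms[unfolded hs.tends_def], of "norm a"] by simp
  have "act (x - y) a = act x a - act y a" for x y
    using act_add_left[of "x - y" y a] by simp
  then show "hs.nrm (act (X n) a - act l a) \<le> norm a * hs.nrm (X n - l)" for n
    using nrm_act[of "X n - l" a] by simp
qed

end

section \<open>The completion of the maps with finitely supported representatives\<close>

lemma fin_supp_add: "f \<in> fin_supp \<Longrightarrow> g \<in> fin_supp \<Longrightarrow> (\<lambda>t. f t + g t :: 'e::complex_vector) \<in> fin_supp"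
  unfolding fin_supp_def
  by (auto intro: finite_subset[of _ "{t. f t \<noteq> 0} \<union> {t. g t \<noteq> 0}"])

lemma fin_supp_map: "f \<in> fin_supp \<Longrightarrow> h 0 = 0 \<Longrightarrow> (\<lambda>t. h (f t)) \<in> fin_supp"
  unfolding fin_supp_def by (auto intro: finite_subset[of _ "{t. f t \<noteq> 0}"])

lemma fin_supp_point_map: "point_map s x \<in> fin_supp"
  unfolding fin_supp_def point_map_def by (auto intro: finite_subset[of _ "{s}"])

text \<open>Built on \<open>L\<close> instead of the kernel: its symmetry and a completion suffice,
  and both kernels give instances over the same module \<open>E\<close>.\<close>

locale kolmogorov_space = E: hilbert_module actE ipE + F: hilbert_module actF ipF
  for actE :: "'e::complex_vector \<Rightarrow> 'a::cstar_algebra \<Rightarrow> 'e" and ipE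
    and actF :: "'f::complex_vector \<Rightarrow> 'a \<Rightarrow> 'f" and ipF +
  fixes L :: "'s \<Rightarrow> 's \<Rightarrow> 'e \<Rightarrow> 'e" and \<iota> :: "('s \<Rightarrow> 'e) \<Rightarrow> 'f"
  assumes completion: "kolm_completion actE ipE L actF ipF \<iota>"
    and L_adjoint: "ipE (L s t x) y = ipE x (L t s y)"
begin

text \<open>Indexing by the representative f lets two completions be compared along the same
  f.\<close>

definition "I f = \<iota> (kolm_hat L f)"

definition "V s x = I (point_map s x)"

lemma L_linear:
  "L s t (x + y) = L s t x + L s t y" "L s t (scaleC c x) = scaleC c (L s t x)"
  "L s t (actE x a) = actE (L s t x) a" "L s t 0 = 0"
proof -
  note adj = L_adjoint[of s t]
  show "L s t (x + y) = L s t x + L s t y" "L s t (scaleC c x) = scaleC c (L s t x)"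
    using E.hs.adjoint_pair_linear[of "L s t" "L t s", OF adj] by auto
  show "L s t (actE x a) = actE (L s t x) a"
    by (rule E.adjoint_pair_act[of "L s t" "L t s", OF adj])
  show "L s t 0 = 0"
    using E.hs.adjoint_pair_linear(2)[of "L s t" "L t s" 0 0, OF adj] scaleR_scaleC[of 0 "L s t 0"] by simp
qed

lemma kolm_hat_sum:
  assumes "finite S" "{t. f t \<noteq> 0} \<subseteq> S" shows "kolm_hat L f s = (\<Sum>t\<in>S. L s t (f t))"
  unfolding kolm_hat_def by (rule sum.mono_neutral_left) (use assms in \<open>auto simp: L_linear\<close>)

lemma kolm_hat_add:
  assumes "f \<in> fin_supp" "g \<in> fin_supp"
  shows "kolm_hat L (\<lambda>t. f t + g t) s = kolm_hat L f s + kolm_hat L g s"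
proof -
  let ?S = "{t. f t \<noteq> 0} \<union> {t. g t \<noteq> 0}"
  have fin: "finite ?S" using assms by (simp add: fin_supp_def)
  show ?thesis
    by (subst (1 2 3) kolm_hat_sum[OF fin]) (auto simp: L_linear sum.distrib)
qed

lemma kolm_hat_map:
  assumes "f \<in> fin_supp" and h: "\<And>s t x. L s t (h x) = h (L s t x)" "\<And>x y. h (x + y) = h x + h y"
  shows "kolm_hat L (\<lambda>t. h (f t)) s = h (kolm_hat L f s)"
proof -
  let ?S = "{t. f t \<noteq> 0}"
  have h0: "h 0 = 0" using h(2)[of 0 0] by simp
  have fin: "finite ?S" using assms by (simp add: fin_supp_def)
  have h_sum: "h (\<Sum>t\<in>A. k t) = (\<Sum>t\<in>A. h (k t))" for A and k :: "'s \<Rightarrow> 'e"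
    by (induction A rule: infinite_finite_induct) (auto simp: h h0)
  show ?thesis
    by (subst (1 2) kolm_hat_sum[OF fin]) (auto simp: h h0 h_sum)
qed

lemma I_add: "f \<in> fin_supp \<Longrightarrow> g \<in> fin_supp \<Longrightarrow> I (\<lambda>t. f t + g t) = I f + I g"
  using completion kolm_hat_add[of f g, THEN ext[of _ "\<lambda>s. kolm_hat L f s + kolm_hat L g s"]]
  unfolding kolm_completion_def I_def by (simp add: Let_def)

lemma I_scaleC: "f \<in> fin_supp \<Longrightarrow> I (\<lambda>t. scaleC c (f t)) = scaleC c (I f)"
  using completion kolm_hat_map[of f "scaleC c", THEN ext[of _ "\<lambda>s. scaleC c (kolm_hat L f s)"]]
  unfolding kolm_completion_def I_def by (simp add: Let_def L_linear scaleC_add_right)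

lemma I_act: "f \<in> fin_supp \<Longrightarrow> I (\<lambda>t. actE (f t) a) = actF (I f) a"
  using completion kolm_hat_map[of f "\<lambda>x. actE x a", THEN ext[of _ "\<lambda>s. actE (kolm_hat L f s) a"]]
  unfolding kolm_completion_def I_def by (simp add: Let_def L_linear E.act_add_left)

lemma I_diff:
  assumes "f \<in> fin_supp" "g \<in> fin_supp" shows "I (\<lambda>t. f t - g t) = I f - I g"
proof -
  have "(\<lambda>t. scaleC (-1) (g t)) \<in> fin_supp" by (rule fin_supp_map[OF assms(2)]) simp
  from I_add[OF assms(1) this] show ?thesis
    using I_scaleC[OF assms(2), of "-1"] by (simp add: scaleC_minus_one)
qed

lemma I_dense: "e > 0 \<Longrightarrow> \<exists>f\<in>fin_supp. F.hs.nrm (y - I f) < e"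
  using completion unfolding kolm_completion_def I_def by (simp add: Let_def)

lemma ip_I:
  assumes "finite S" "{t. f t \<noteq> 0} \<subseteq> S" "{t. g t \<noteq> 0} \<subseteq> S"
  shows "ipF (I f) (I g) = (\<Sum>s\<in>S. \<Sum>t\<in>S. ipE (L s t (f t)) (g s))"
proof -
  have "f \<in> fin_supp" "g \<in> fin_supp" using assms finite_subset by (auto simp: fin_supp_def)
  then have "ipF (I f) (I g) = (\<Sum>s | g s \<noteq> 0. \<Sum>t | f t \<noteq> 0. ipE (L s t (f t)) (g s))"
    using completion unfolding kolm_completion_def I_def by (simp add: Let_def)
  also have "\<dots> = (\<Sum>s | g s \<noteq> 0. \<Sum>t\<in>S. ipE (L s t (f t)) (g s))"
    by (intro sum.cong sum.mono_neutral_left) (use assms in \<open>auto simp: L_linear\<close>)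
  also have "\<dots> = (\<Sum>s\<in>S. \<Sum>t\<in>S. ipE (L s t (f t)) (g s))"
    by (intro sum.mono_neutral_left) (use assms in auto)
  finally show ?thesis .
qed

text \<open>Reproducing property: on the dense part, evaluation at s is the adjoint of
  \<open>V s\<close>.\<close>

lemma ip_V_I:
  assumes "f \<in> fin_supp" shows "ipF (V s x) (I f) = ipE x (kolm_hat L f s)"
proof -
  let ?S = "insert s {t. f t \<noteq> 0}"
  have fin: "finite ?S" using assms by (simp add: fin_supp_def)
  have "ipF (V s x) (I f) = (\<Sum>r\<in>?S. \<Sum>t\<in>?S. ipE (L r t (point_map s x t)) (f r))"
    unfolding V_def by (rule ip_I[OF fin]) (auto simp: point_map_def)
  also have "\<dots> = (\<Sum>r\<in>?S. ipE (L r s x) (f r))"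
  proof (rule sum.cong[OF refl])
    fix r
    have "(\<Sum>t\<in>?S. ipE (L r t (point_map s x t)) (f r)) = (\<Sum>t\<in>?S. if t = s then ipE (L r s x) (f r) else 0)"
      by (rule sum.cong) (auto simp: point_map_def L_linear)
    then show "(\<Sum>t\<in>?S. ipE (L r t (point_map s x t)) (f r)) = ipE (L r s x) (f r)"
      using fin by (simp only: sum.delta) simp
  qed
  also have "\<dots> = ipE x (kolm_hat L f s)"
    by (subst kolm_hat_sum[OF fin]) (auto simp: L_adjoint E.hs.ip_sum_right)
  finally show ?thesis .
qed

lemma ip_V: "ipF (V s x) (V t y) = ipE x (L s t y)"
proof -
  have "kolm_hat L (point_map t y) s = L s t y"
    by (subst kolm_hat_sum[of "{t}"]) (auto simp: point_map_def)
  then show ?thesis using ip_V_I[OF fin_supp_point_map, of s x t y] by (simp add: V_def)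
qed

text \<open>The adjoint of \<open>V s\<close> extends the evaluation at \<open>s\<close> to the completion.\<close>

lemma V_adjointable: "V s \<in> adjointables ipE ipF"
proof -
  have "E.hs.bop (L s s)" by (rule E.hs.adjoint_pair_bop[OF L_adjoint])
  then obtain c where c: "c > 0" "\<And>x. E.hs.nrm (L s s x) \<le> c * E.hs.nrm x"
    using E.hs.bop_bound by blast
  have Vc: "F.hs.nrm (V s x) \<le> sqrt c * E.hs.nrm x" for x
  proof (rule power2_le_imp_le)
    have "(F.hs.nrm (V s x))\<^sup>2 \<le> E.hs.nrm x * (c * E.hs.nrm x)"
      unfolding F.hs.nrm_power2 ip_V by (intro order_trans[OF E.hs.ip_Cauchy_Schwarz] mult_left_mono c) simp
    then show "(F.hs.nrm (V s x))\<^sup>2 \<le> (sqrt c * E.hs.nrm x)\<^sup>2"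
      using c(1) by (simp add: power_mult_distrib) (simp add: power2_eq_square mult_ac)
  qed (use c(1) in auto)
  \<comment> \<open>Pairing I f with \<open>V s\<close> of the value at s itself gives the square of
    that value's norm, so evaluation is bounded by the bound of \<open>V s\<close>.\<close>
  have hat_bound: "E.hs.nrm (kolm_hat L f s) \<le> sqrt c * F.hs.nrm (I f)" if "f \<in> fin_supp" for f
  proof -
    let ?x = "kolm_hat L f s"
    have "(E.hs.nrm ?x)\<^sup>2 = norm (ipF (V s ?x) (I f))"
      unfolding E.hs.nrm_power2 ip_V_I[OF that] ..
    also have "\<dots> \<le> (sqrt c * E.hs.nrm ?x) * F.hs.nrm (I f)"
      by (intro order_trans[OF F.hs.ip_Cauchy_Schwarz] mult_right_mono Vc) simp
    finally have "E.hs.nrm ?x * E.hs.nrm ?x \<le> E.hs.nrm ?x * (sqrt c * F.hs.nrm (I f))"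
      by (simp add: power2_eq_square mult_ac)
    then show ?thesis using c(1) E.hs.nrm_ge_0[of ?x] by (cases "E.hs.nrm ?x = 0") (auto simp: mult_le_cancel_left)
  qed
  have diff_bound: "E.hs.nrm (kolm_hat L f s - kolm_hat L g s) \<le> sqrt c * F.hs.nrm (I f - I g)"
    if f: "f \<in> fin_supp" and g: "g \<in> fin_supp" for f g
  proof -
    have d: "(\<lambda>t. f t - g t) \<in> fin_supp"
      using fin_supp_add[OF f fin_supp_map[OF g, of uminus]] by simp
    have "kolm_hat L (\<lambda>t. f t - g t) s = kolm_hat L f s - kolm_hat L g s"
      using kolm_hat_add[OF d g, of s] by simp
    then show ?thesis using hat_bound[OF d] I_diff[OF f g] by simp
  qed
  obtain W where W: "\<And>y. \<exists>U. range U \<subseteq> fin_supp \<and> F.hs.tends (\<lambda>n. I (U n)) y"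
    "\<And>y U. range U \<subseteq> fin_supp \<Longrightarrow> F.hs.tends (\<lambda>n. I (U n)) y \<Longrightarrow>
      E.hs.tends (\<lambda>n. kolm_hat L (U n) s) (W y)"
    by (rule continuous_extension[OF F.ip_space_axiom E.ip_space_axiom I_dense diff_bound]) (assumption+, rule that)
  show ?thesis
  proof (rule adjointablesI[where T' = W])
    fix x y
    obtain U where U: "range U \<subseteq> fin_supp" "F.hs.tends (\<lambda>n. I (U n)) y" using W(1) by blast
    have "ipF (V s x) (I (U n)) = ipE x (kolm_hat L (U n) s)" for n
      using U(1) by (intro ip_V_I) auto
    then show "ipF (V s x) y = ipE x (W y)"
      using LIMSEQ_unique[OF F.hs.tends_ip_right[OF U(2), of "V s x"]]
        E.hs.tends_ip_right[OF W(2)[OF U], of x] by simp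
  qed
qed

lemma V_adjoint: "ipE x (hm_adjoint ipE ipF (V s) y) = ipF (V s x) y"
  by (rule hm_adjoint_ip[OF V_adjointable, symmetric])

end

section \<open>Recovering kernels from L, and the two implications\<close>

lemma hermitian_kernel_adjoint:
  assumes "hermitian_kernel ip K" shows "ip (K s t x) y = ip x (K t s y)"
  using assms hm_adjoint_ip[of "K s t" ip ip x y] unfolding hermitian_kernel_def by metis

context hilbert_module
begin

lemma hermitian_kernelI:
  assumes "\<And>s t x y. ip (K s t x) y = ip x (K t s y)" shows "hermitian_kernel ip K"
  unfolding hermitian_kernel_def
  using adjointablesI[of ip "K s t" ip "K t s" for s t, OF assms]
    hs.hm_adjoint_eq[of ip "K s t" "K t s" for s t, OF assms] by blast

lemma kolm_L_adjoint:
  assumes "hermitian_kernel ip K"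
  shows "ip (kolm_L K s0 s t x) y = ip x (kolm_L K s0 t s y)"
  by (simp add: kolm_L_def hs.ip_simps hermitian_kernel_adjoint[OF assms] algebra_simps)

text \<open>This is the case h = 0. Self-adjointness gives K(s0, s) = K(s, s0), and with zero
  diagonal L(s, s) = - K(s, s0), so the base-point terms cancel.\<close>

lemma kernel_via_kolm_L:
  assumes "hermitian_kernel ip K" and sa: "\<And>s. self_adjoint_op ip (K s s0)"
    and diag: "\<And>s x. K s s x = 0"
  shows "K s t x = 2 *\<^sub>R kolm_L K s0 s t x - kolm_L K s0 s s x - kolm_L K s0 t t x"
proof -
  have base: "K s0 s = K s s0" for s
    using sa[of s] assms(1) unfolding self_adjoint_op_def hermitian_kernel_def by metis
  have kolm_L_diag: "kolm_L K s0 s s x = - K s s0 x" for s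
  proof -
    have "- K s s0 x - K s s0 x = 2 *\<^sub>R (- K s s0 x)" by (simp add: scaleR_2)
    then show ?thesis by (simp add: kolm_L_def diag base[of s])
  qed
  show ?thesis unfolding kolm_L_diag by (simp add: kolm_L_def diag base[of t])
qed

end

context kolmogorov_space
begin

text \<open>For K' the kernel \<open>Q\<close> plays the part of \<open>L\<close>, so both forms
  reduce to inner products of one vector X and of C X.\<close>

lemma kernel_le_if_contraction:
  assumes K: "hermitian_kernel ipE K" "\<And>s t x. K s t x = 2 *\<^sub>R L s t x - L s s x - L t t x"
    and K': "hermitian_kernel ipE K'"
    and C: "C \<in> adjointables ipF ipF" "hm_op_norm ipF ipF C \<le> 1"
    and K'_C: "\<And>s t x. K' s t x =
        2 *\<^sub>R hm_adjoint ipE ipF (V s) (hm_adjoint ipF ipF C (C (V t x)))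
        - hm_adjoint ipE ipF (V s) (hm_adjoint ipF ipF C (C (V s x)))
        - hm_adjoint ipE ipF (V t) (hm_adjoint ipF ipF C (C (V t x)))"
  shows "kernel_le ipE K' K"
proof -
  define C' where "C' = hm_adjoint ipF ipF C"
  define Q where "Q = (\<lambda>s t x. hm_adjoint ipE ipF (V s) (C' (C (V t x))))"
  have adjC: "ipF (C x) y = ipF x (C' y)" for x y unfolding C'_def by (rule hm_adjoint_ip[OF C(1)])
  then have adjC': "ipF (C' x) y = ipF x (C y)" for x y by (metis F.ip_star)
  note lC = F.hs.bopD[OF F.hs.adjoint_pair_bop[of C C', OF adjC]]
  note lC' = F.hs.bopD[OF F.hs.adjoint_pair_bop[of C' C, OF adjC']]
  have unit: "F.hs.nrm (C x) \<le> 1" if "F.hs.nrm x \<le> 1" for x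
  proof -
    have "ennreal (F.hs.nrm (C x)) \<le> hm_op_norm ipF ipF C"
      unfolding hm_op_norm_def using that by (intro SUP_upper) simp
    then have "ennreal (F.hs.nrm (C x)) \<le> 1" using C(2) by (rule order_trans)
    then show ?thesis by simp
  qed
  have contr: "F.hs.nrm (C x) \<le> 1 * F.hs.nrm x" for x
  proof (cases "x = 0")
    case False
    then have "F.hs.nrm x > 0" using F.hs.nrm_ge_0[of x] F.hs.nrm_eq_0[of x] by linarith
    then show ?thesis using unit[of "(1 / F.hs.nrm x) *\<^sub>R x"]
      by (simp add: lC F.hs.nrm_scaleR field_simps)
  qed (simp add: lC)
  have "F.hs.nrm (C' (C x)) \<le> F.hs.nrm x" for x
    using F.hs.adjoint_bop_bound[of C C' 1, OF adjC contr, of "C x"] contr[of x] by simp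
  moreover have "F.hs.symm (\<lambda>x. C' (C x))" by (rule F.hs.symmI) (simp add: adjC adjC')
  \<comment> \<open>R is the root of 1 - C' C; it displays <X, X> - <C X, C X> as <R X, R
    X>.\<close>
  ultimately obtain R where R: "F.hs.symm R" "\<And>x. R (R x) = x - C' (C x)"
    using F.hs.symm_sqrt by metis
  have Q_ip: "ipE x (Q s t y) = ipF (C (V s x)) (C (V t y))" for s t x y
    by (simp add: Q_def V_adjoint adjC)
  then have Q_adj: "ipE (Q s t x) y = ipE x (Q t s y)" for s t x y by (metis E.ip_star F.ip_star)
  have K'_Q: "K' s t x = 2 *\<^sub>R Q s t x - Q s s x - Q t t x" for s t x
    unfolding Q_def C'_def by (rule K'_C)
  define M where "M = (\<lambda>s t x. K s t x - K' s t x)"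
  have M_adj: "ipE (M s t x) y = ipE x (M t s y)" for s t x y
    by (simp add: M_def E.hs.ip_simps hermitian_kernel_adjoint[OF K(1)] hermitian_kernel_adjoint[OF K'])
  have "cond_pos_def_kernel ipE M"
    unfolding cond_pos_def_kernel_def
  proof (intro conjI allI impI)
    show "hermitian_kernel ipE M" by (rule E.hermitian_kernelI[OF M_adj])
    fix n :: nat and p :: "nat \<Rightarrow> 's" and b :: "nat \<Rightarrow> 'e \<Rightarrow> 'e"
    assume b: "n \<ge> 2 \<and> (\<forall>i<n. b i \<in> adjointables ipE ipE) \<and> (\<forall>x. (\<Sum>i<n. b i x) = 0)"
    let ?P = "\<lambda>x. \<Sum>i<n. \<Sum>j<n. hm_adjoint ipE ipE (b i) (M (p i) (p j) (b j x))"
    have b_adj: "ipE x (hm_adjoint ipE ipE (b i) y) = ipE (b i x) y" if "i < n" for i x y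
      using hm_adjoint_ip[of "b i" ipE ipE x y] b that by simp
    have P: "ipE x (?P y) = (\<Sum>i<n. \<Sum>j<n. ipE (b i x) (M (p i) (p j) (b j y)))" for x y
      by (simp add: E.hs.ip_sum_right b_adj)
    show "positive_op ipE ?P"
    proof (rule E.positive_opI)
      show "E.hs.symm ?P"
      proof (rule E.hs.symmI)
        fix x y
        have sum_star: "star (\<Sum>i\<in>A. h i) = (\<Sum>i\<in>A. star (h i))" for A :: "nat set" and h :: "nat \<Rightarrow> 'a"
          by (induction A rule: infinite_finite_induct) (auto simp: star_add)
        have "ipE (?P x) y = star (ipE y (?P x))" by (simp add: E.ip_star)
        also have "\<dots> = (\<Sum>i<n. \<Sum>j<n. ipE (b j x) (M (p j) (p i) (b i y)))"
          unfolding P by (simp add: sum_star E.ip_star M_adj)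
        also have "\<dots> = ipE x (?P y)" unfolding P by (rule sum.swap)
        finally show "ipE (?P x) y = ipE x (?P y)" .
      qed
      fix x
      define X where "X = (\<Sum>i<n. V (p i) (b i x))"
      have sum_b: "(\<Sum>i<n. b i x) = 0" using b by blast
      have C_sum: "C (\<Sum>i\<in>A. h i) = (\<Sum>i\<in>A. C (h i))" for A :: "nat set" and h
        by (induction A rule: infinite_finite_induct) (auto simp: lC)
      have "ipE x (?P x) = (\<Sum>i<n. \<Sum>j<n. ipE (b i x) (K (p i) (p j) (b j x)))
          - (\<Sum>i<n. \<Sum>j<n. ipE (b i x) (K' (p i) (p j) (b j x)))"
        unfolding P by (simp add: M_def E.hs.ip_diff_right sum_subtractf)
      also have "(\<Sum>i<n. \<Sum>j<n. ipE (b i x) (K (p i) (p j) (b j x)))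
          = 2 *\<^sub>R (\<Sum>i<n. \<Sum>j<n. ipE (b i x) (L (p i) (p j) (b j x)))"
        by (rule E.hs.sum_centered_kernel[OF _ L_adjoint K(2) sum_b]) simp
      also have "(\<Sum>i<n. \<Sum>j<n. ipE (b i x) (L (p i) (p j) (b j x))) = ipF X X"
        by (subst sum.swap) (simp add: X_def F.hs.ip_sum_left F.hs.ip_sum_right ip_V)
      also have "(\<Sum>i<n. \<Sum>j<n. ipE (b i x) (K' (p i) (p j) (b j x)))
          = 2 *\<^sub>R (\<Sum>i<n. \<Sum>j<n. ipE (b i x) (Q (p i) (p j) (b j x)))"
        by (rule E.hs.sum_centered_kernel[OF _ Q_adj K'_Q sum_b]) simp
      also have "(\<Sum>i<n. \<Sum>j<n. ipE (b i x) (Q (p i) (p j) (b j x))) = ipF (C X) (C X)"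
        by (subst sum.swap) (simp add: X_def C_sum F.hs.ip_sum_left F.hs.ip_sum_right Q_ip)
      also have "2 *\<^sub>R ipF X X - 2 *\<^sub>R ipF (C X) (C X) = 2 *\<^sub>R ipF (R X) (R X)"
        by (simp add: F.hs.symm_ip[OF R(1)] R(2) F.hs.ip_diff_right scaleR_diff_right adjC)
      finally show "positive_elem (ipE x (?P x))"
        using positive_elem_scaleR[OF F.positive_elem_ip, of 2 "R X"] by simp
    qed
  qed
  then show ?thesis unfolding kernel_le_def M_def .
qed

end

text \<open>Norm monotonicity turns the domination into a contraction \<open>W\<close> that maps the
  vectors of the first decomposition to those of the second. Hence T = W' W compresses to
  \<open>L'\<close>, and so does C' C for any self-adjoint root C of T; the positive root is
  taken.\<close>

lemma contraction_if_dominated: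
  assumes "kolmogorov_space actE ipE actF ipF L \<iota>" and "kolmogorov_space actE ipE actG ipG L' \<iota>'"
    and sd: "self_dual actF ipF"
    and dom: "\<And>f. f \<in> fin_supp \<Longrightarrow> positive_elem
      (ipF (kolmogorov_space.I L \<iota> f) (kolmogorov_space.I L \<iota> f)
        - ipG (kolmogorov_space.I L' \<iota>' f) (kolmogorov_space.I L' \<iota>' f))"
  obtains C where "C \<in> adjointables ipF ipF" "positive_op ipF C" "hm_op_norm ipF ipF C \<le> 1"
    "\<And>s t x. hm_adjoint ipE ipF (kolmogorov_space.V L \<iota> s)
      (hm_adjoint ipF ipF C (C (kolmogorov_space.V L \<iota> t x))) = L' s t x"
proof -
  interpret KF: kolmogorov_space actE ipE actF ipF L \<iota> by fact
  interpret KG: kolmogorov_space actE ipE actG ipG L' \<iota>' by fact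
  have bound: "KG.F.hs.nrm (KG.I f - KG.I g) \<le> 1 * KF.F.hs.nrm (KF.I f - KF.I g)"
    if fg: "f \<in> fin_supp" "g \<in> fin_supp" for f g
  proof (rule power2_le_imp_le)
    have "(\<lambda>t. f t - g t) \<in> fin_supp"
      using fin_supp_add[OF fg(1) fin_supp_map[OF fg(2), of uminus]] by simp
    from norm_mono_positive_elem[OF KG.F.positive_elem_ip dom[OF this]]
    show "(KG.F.hs.nrm (KG.I f - KG.I g))\<^sup>2 \<le> (1 * KF.F.hs.nrm (KF.I f - KF.I g))\<^sup>2"
      by (simp add: KF.F.hs.nrm_power2 KG.F.hs.nrm_power2 KF.I_diff[OF fg] KG.I_diff[OF fg])
  qed simp
  obtain W where dense: "\<And>y. \<exists>U. range U \<subseteq> fin_supp \<and> KF.F.hs.tends (\<lambda>n. KF.I (U n)) y"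
    and W: "\<And>y U. range U \<subseteq> fin_supp \<Longrightarrow> KF.F.hs.tends (\<lambda>n. KF.I (U n)) y \<Longrightarrow>
      KG.F.hs.tends (\<lambda>n. KG.I (U n)) (W y)"
    by (rule continuous_extension[OF KF.F.ip_space_axiom KG.F.ip_space_axiom KF.I_dense bound])
      (assumption+, rule that)
  have W_add: "W (y + z) = W y + W z" for y z
  proof -
    obtain X where X: "range X \<subseteq> fin_supp" "KF.F.hs.tends (\<lambda>n. KF.I (X n)) y" using dense by blast
    obtain Y where Y: "range Y \<subseteq> fin_supp" "KF.F.hs.tends (\<lambda>n. KF.I (Y n)) z" using dense by blast
    have XY: "X n \<in> fin_supp" "Y n \<in> fin_supp" for n using X Y by auto
    have r: "range (\<lambda>n t. X n t + Y n t) \<subseteq> fin_supp" using fin_supp_add[OF XY] by blast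
    have "KF.F.hs.tends (\<lambda>n. KF.I (\<lambda>t. X n t + Y n t)) (y + z)"
      using KF.F.hs.tends_add[OF X(2) Y(2)] by (simp add: KF.I_add XY)
    moreover have "KG.F.hs.tends (\<lambda>n. KG.I (\<lambda>t. X n t + Y n t)) (W y + W z)"
      using KG.F.hs.tends_add[OF W[OF X] W[OF Y]] by (simp add: KG.I_add XY)
    ultimately show ?thesis by (rule KG.F.hs.tends_unique[OF W[OF r]])
  qed
  have W_scaleC: "W (scaleC c y) = scaleC c (W y)" for c y
  proof -
    obtain X where X: "range X \<subseteq> fin_supp" "KF.F.hs.tends (\<lambda>n. KF.I (X n)) y" using dense by blast
    have X': "X n \<in> fin_supp" for n using X by auto
    have r: "range (\<lambda>n t. scaleC c (X n t)) \<subseteq> fin_supp" using fin_supp_map[OF X', of "scaleC c"] by auto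
    have "KF.F.hs.tends (\<lambda>n. KF.I (\<lambda>t. scaleC c (X n t))) (scaleC c y)"
      using KF.F.hs.tends_scaleC[OF X(2)] by (simp add: KF.I_scaleC X')
    moreover have "KG.F.hs.tends (\<lambda>n. KG.I (\<lambda>t. scaleC c (X n t))) (scaleC c (W y))"
      using KG.F.hs.tends_scaleC[OF W[OF X]] by (simp add: KG.I_scaleC X')
    ultimately show ?thesis by (rule KG.F.hs.tends_unique[OF W[OF r]])
  qed
  have W_act: "W (actF y a) = actG (W y) a" for y a
  proof -
    obtain X where X: "range X \<subseteq> fin_supp" "KF.F.hs.tends (\<lambda>n. KF.I (X n)) y" using dense by blast
    have X': "X n \<in> fin_supp" for n using X by auto
    have "actE 0 a = 0" using KF.E.act_add_left[of 0 0 a] by simp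
    then have r: "range (\<lambda>n t. actE (X n t) a) \<subseteq> fin_supp"
      using fin_supp_map[OF X', of "\<lambda>x. actE x a"] by auto
    have "KF.F.hs.tends (\<lambda>n. KF.I (\<lambda>t. actE (X n t) a)) (actF y a)"
      using KF.F.tends_act[OF X(2)] by (simp add: KF.I_act X')
    moreover have "KG.F.hs.tends (\<lambda>n. KG.I (\<lambda>t. actE (X n t) a)) (actG (W y) a)"
      using KG.F.tends_act[OF W[OF X]] by (simp add: KG.I_act X')
    ultimately show ?thesis by (rule KG.F.hs.tends_unique[OF W[OF r]])
  qed
  have W_I: "W (KF.I f) = KG.I f" if "f \<in> fin_supp" for f
    by (rule KG.F.hs.tends_unique[OF W KG.F.hs.tends_const]) (use that KF.F.hs.tends_const in auto)
  have W_contr: "KG.F.hs.nrm (W y) \<le> KF.F.hs.nrm y" for y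
  proof -
    obtain X where X: "range X \<subseteq> fin_supp" "KF.F.hs.tends (\<lambda>n. KF.I (X n)) y" using dense by blast
    have "KG.F.hs.nrm (KG.I (X n)) \<le> KF.F.hs.nrm (KF.I (X n))" for n
    proof (rule power2_le_imp_le)
      have "X n \<in> fin_supp" using X by auto
      from norm_mono_positive_elem[OF KG.F.positive_elem_ip dom[OF this]]
      show "(KG.F.hs.nrm (KG.I (X n)))\<^sup>2 \<le> (KF.F.hs.nrm (KF.I (X n)))\<^sup>2"
        by (simp add: KF.F.hs.nrm_power2 KG.F.hs.nrm_power2)
    qed simp
    then show ?thesis
      using LIMSEQ_le[OF KG.F.hs.tends_nrm[OF W[OF X]] KF.F.hs.tends_nrm[OF X(2)]] by blast
  qed
  \<comment> \<open>x maps to <z, W x> boundedly and linearly over the algebra, so self-duality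
    represents it by a vector, the value of the adjoint at z.\<close>
  have "\<exists>w. \<forall>x. ipG z (W x) = ipF w x" for z
  proof -
    have "\<exists>M. \<forall>x. norm (ipG z (W x)) \<le> M * KF.F.hs.nrm x"
      using order_trans[OF KG.F.hs.ip_Cauchy_Schwarz mult_left_mono[OF W_contr]] by fastforce
    moreover have "ipG z (W (x + y)) = ipG z (W x) + ipG z (W y)"
      "ipG z (W (scaleC c x)) = scaleC c (ipG z (W x))" "ipG z (W (actF x a)) = ipG z (W x) * a" for x y c a
      by (simp_all add: W_add W_scaleC W_act KG.F.ip_add_right KG.F.ip_scaleC_right KG.F.ip_act_right)
    ultimately show ?thesis using sd[unfolded self_dual_def, rule_format, of "\<lambda>x. ipG z (W x)"] by blast
  qed
  then obtain W' where W': "\<And>z x. ipG z (W x) = ipF (W' z) x" by metis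
  define T where "T = (\<lambda>x. W' (W x))"
  have T_left: "ipF (T x) y = ipG (W x) (W y)" for x y by (simp add: T_def W')
  then have T_right: "ipF x (T y) = ipG (W x) (W y)" for x y by (metis KF.F.ip_star KG.F.ip_star)
  have T: "KF.F.hs.symm T" by (rule KF.F.hs.symmI) (simp add: T_left T_right)
  \<comment> \<open>\<open>W\<close> runs between two modules, so
    \<open>npos_adjoint_times_self\<close> does not apply. The root \<open>D\<close> obtained from
    the form is a contraction, which yields \<open>npos T\<close> with constant 1 and thereby a
    positive root.\<close>
  obtain D where D: "KF.F.hs.symm D" "\<And>x. D (D x) = T x"
    using KF.F.square_if_form_positive[OF T] KG.F.positive_elem_ip unfolding T_right by metis
  have "(KF.F.hs.nrm (D x))\<^sup>2 \<le> 1 * (KF.F.hs.nrm x)\<^sup>2" for x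
    unfolding KF.F.hs.symm_nrm_power2[OF D(1)] D(2) T_right
    using power_mono[OF W_contr, of x 2] by (simp add: KG.F.hs.nrm_power2)
  from KF.F.hs.square_gap_bound[OF D(1) _ this]
  have "KF.F.hs.nrm (1 *\<^sub>R x - T x) \<le> 1 * KF.F.hs.nrm x" for x by (simp add: D(2))
  then have "KF.F.hs.npos T" unfolding KF.F.hs.npos_def using T zero_le_one by blast
  then obtain C where C: "KF.F.hs.npos C" "\<And>x. C (C x) = T x"
    using KF.F.hs.npos_sqrt by (metis (full_types))
  \<comment> \<open>A root of \<open>C\<close>, taken to exhibit the form of \<open>C\<close> as
    positive.\<close>
  obtain B where B: "KF.F.hs.npos B" "\<And>x. B (B x) = C x"
    using KF.F.hs.npos_sqrt[OF C(1)] by (metis (full_types))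
  note sC = KF.F.hs.npos_symm[OF C(1)] and sB = KF.F.hs.npos_symm[OF B(1)]
  have adjC: "hm_adjoint ipF ipF C = C" by (rule KF.F.hs.hm_adjoint_eq) (rule KF.F.hs.symm_ip[OF sC])
  show thesis
  proof (rule that[of C])
    show "C \<in> adjointables ipF ipF" by (rule adjointablesI) (rule KF.F.hs.symm_ip[OF sC])
    show "positive_op ipF C"
    proof (rule KF.F.positive_opI[OF sC])
      fix x
      have "ipF x (C x) = ipF (B x) (B x)" by (simp add: KF.F.hs.symm_ip[OF sB] B(2))
      then show "positive_elem (ipF x (C x))" using KF.F.positive_elem_ip by simp
    qed
    show "hm_op_norm ipF ipF C \<le> 1"
      unfolding hm_op_norm_def
    proof (rule SUP_least)
      fix x assume x: "x \<in> {x. KF.F.hs.nrm x \<le> 1}"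
      have "KF.F.hs.nrm (C x) \<le> KF.F.hs.nrm x"
      proof (rule power2_le_imp_le)
        show "(KF.F.hs.nrm (C x))\<^sup>2 \<le> (KF.F.hs.nrm x)\<^sup>2"
          unfolding KF.F.hs.symm_nrm_power2[OF sC] C(2) T_right
          using power_mono[OF W_contr, of x 2] by (simp add: KG.F.hs.nrm_power2)
      qed simp
      then show "ennreal (KF.F.hs.nrm (C x)) \<le> 1" using x by simp
    qed
    show "hm_adjoint ipE ipF (KF.V s) (hm_adjoint ipF ipF C (C (KF.V t x))) = L' s t x" for s t x
    proof (rule KF.E.hs.ip_eqI)
      fix z
      have "W (KF.V r y) = KG.V r y" for r y
        by (simp add: KF.V_def KG.V_def W_I fin_supp_point_map)
      then show "ipE z (hm_adjoint ipE ipF (KF.V s) (hm_adjoint ipF ipF C (C (KF.V t x)))) = ipE z (L' s t x)"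
        by (simp add: adjC C(2) KF.V_adjoint T_right KG.ip_V)
    qed
  qed
qed

text \<open>The values of \<open>f\<close>, completed by their negative sum at the base point, form a family with
  zero sum; the base point does not contribute because \<open>L\<close> and \<open>L'\<close> vanish there.\<close>

lemma kolm_forms_dominated:
  assumes "kolmogorov_space actE ipE actF ipF L \<iota>" and "kolmogorov_space actE ipE actG ipG L' \<iota>'"
    and K: "\<And>s t x. K s t x = 2 *\<^sub>R L s t x - L s s x - L t t x"
    and K': "\<And>s t x. K' s t x = 2 *\<^sub>R L' s t x - L' s s x - L' t t x"
    and base: "\<And>s x. L s s0 x = 0" "\<And>s x. L' s s0 x = 0" "\<And>s x. L s0 s x = 0" "\<And>s x. L' s0 s x = 0"
    and le: "kernel_le ipE K' K" and f: "f \<in> fin_supp"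
  shows "positive_elem (ipF (kolmogorov_space.I L \<iota> f) (kolmogorov_space.I L \<iota> f)
        - ipG (kolmogorov_space.I L' \<iota>' f) (kolmogorov_space.I L' \<iota>' f))"
proof -
  interpret KF: kolmogorov_space actE ipE actF ipF L \<iota> by fact
  interpret KG: kolmogorov_space actE ipE actG ipG L' \<iota>' by fact
  define S where "S = {t. f t \<noteq> 0}"
  have S: "finite S" using f by (simp add: S_def fin_supp_def)
  define Lm where "Lm = (\<lambda>s t x. L s t x - L' s t x)"
  have Lm_adj: "ipE (Lm s t x) y = ipE x (Lm t s y)" for s t x y
    by (simp add: Lm_def KF.E.hs.ip_simps KF.L_adjoint KG.L_adjoint)
  have eq: "ipF (KF.I f) (KF.I f) - ipG (KG.I f) (KG.I f) = (\<Sum>s\<in>S. \<Sum>t\<in>S. ipE (f s) (Lm s t (f t)))"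
  proof -
    have "ipF (KF.I f) (KF.I f) - ipG (KG.I f) (KG.I f) = (\<Sum>s\<in>S. \<Sum>t\<in>S. ipE (Lm s t (f t)) (f s))"
      by (subst KF.ip_I[OF S], simp add: S_def, simp add: S_def, subst KG.ip_I[OF S], simp add: S_def,
          simp add: S_def, simp add: Lm_def KF.E.hs.ip_diff_left sum_subtractf)
    also have "\<dots> = (\<Sum>s\<in>S. \<Sum>t\<in>S. ipE (f t) (Lm t s (f s)))" by (simp add: Lm_adj)
    also have "\<dots> = (\<Sum>s\<in>S. \<Sum>t\<in>S. ipE (f s) (Lm s t (f t)))" by (rule sum.swap)
    finally show ?thesis .
  qed
  obtain h where h: "bij_betw h {..<card S} S"
    using ex_bij_betw_nat_finite[OF S] by (auto simp: atLeast0LessThan)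
  define m where "m = card S"
  show ?thesis
  \<comment> \<open>The family has m + 1 members, and conditional positivity asks for at least
    two.\<close>
  proof (cases "m = 0")
    case True
    then have "S = {}" using S by (simp add: m_def)
    then show ?thesis unfolding eq by (simp add: positive_elem_zero)
  next
    case False
    define p where "p = (\<lambda>i. if i < m then h i else s0)"
    define u where "u = (\<lambda>i. if i < m then f (h i) else - (\<Sum>j<m. f (h j)))"
    have u: "(\<Sum>i<Suc m. u i) = 0" by (simp add: u_def)
    have "positive_elem (\<Sum>i<Suc m. \<Sum>j<Suc m. ipE (u i) (K (p i) (p j) (u j) - K' (p i) (p j) (u j)))"
      by (rule KF.E.cond_pos_def_kernel_form[OF le[unfolded kernel_le_def] _ u]) (use False in simp)
    moreover have "(\<Sum>i<Suc m. \<Sum>j<Suc m. ipE (u i) (K (p i) (p j) (u j) - K' (p i) (p j) (u j)))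
        = 2 *\<^sub>R (\<Sum>i<Suc m. \<Sum>j<Suc m. ipE (u i) (Lm (p i) (p j) (u j)))"
    proof (rule KF.E.hs.sum_centered_kernel[OF finite_lessThan Lm_adj _ u, where K = "\<lambda>s t x. K s t x - K' s t x"])
      show "K s t x - K' s t x = 2 *\<^sub>R Lm s t x - Lm s s x - Lm t t x" for s t x
        unfolding K[of s t x] K'[of s t x] Lm_def by (simp add: scaleR_diff_right)
    qed
    moreover have "(\<Sum>i<Suc m. \<Sum>j<Suc m. ipE (u i) (Lm (p i) (p j) (u j)))
        = (\<Sum>s\<in>S. \<Sum>t\<in>S. ipE (f s) (Lm s t (f t)))"
    proof -
      have re: "(\<Sum>s\<in>S. q s) = (\<Sum>i<m. q (h i))" for q :: "'d \<Rightarrow> 'b"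
        using sum.reindex_bij_betw[OF h, of q] by (simp add: m_def)
      have "(\<Sum>i<Suc m. \<Sum>j<Suc m. ipE (u i) (Lm (p i) (p j) (u j)))
          = (\<Sum>i<m. \<Sum>j<m. ipE (f (h i)) (Lm (h i) (h j) (f (h j))))"
        by (simp add: p_def u_def Lm_def base)
      then show ?thesis by (simp add: re)
    qed
    ultimately have "positive_elem (2 *\<^sub>R (\<Sum>s\<in>S. \<Sum>t\<in>S. ipE (f s) (Lm s t (f t))))" by simp
    from positive_elem_scaleR[OF this, of "1/2"] show ?thesis unfolding eq by simp
  qed
qed

theorem theorem3p4:
  fixes actE :: "'e::complex_vector \<Rightarrow> 'a::cstar_algebra \<Rightarrow> 'e"
    and ipE :: "'e \<Rightarrow> 'e \<Rightarrow> 'a"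
    and K K' :: "'s \<Rightarrow> 's \<Rightarrow> 'e \<Rightarrow> 'e"
    and s0 :: 's
    and actF :: "'f::complex_vector \<Rightarrow> 'a \<Rightarrow> 'f"
    and ipF :: "'f \<Rightarrow> 'f \<Rightarrow> 'a"
    and V :: "'s \<Rightarrow> 'e \<Rightarrow> 'f"
    and actF' :: "'g::complex_vector \<Rightarrow> 'a \<Rightarrow> 'g"
    and ipF' :: "'g \<Rightarrow> 'g \<Rightarrow> 'a"
    and V' :: "'s \<Rightarrow> 'e \<Rightarrow> 'g"
  assumes "hilbert_module actE ipE"
    and "cond_pos_def_kernel ipE K"
    and "cond_pos_def_kernel ipE K'"
    and "\<And>s. self_adjoint_op ipE (K s s0)"
    and "\<And>s. self_adjoint_op ipE (K' s s0)"
    and "\<And>s x. K s s x = 0"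
    and "\<And>s x. K' s s x = 0"
    and "min_kolmogorov actE ipE K s0 actF ipF V"
    and "self_dual actF ipF"
    and "min_kolmogorov actE ipE K' s0 actF' ipF' V'"
    and "self_dual actF' ipF'"
  shows "kernel_le ipE K' K \<longleftrightarrow>
    (\<exists>C \<in> adjointables ipF ipF. positive_op ipF C \<and> hm_op_norm ipF ipF C \<le> 1 \<and>
      (\<forall>s t x. K' s t x =
        2 *\<^sub>R hm_adjoint ipE ipF (V s) (hm_adjoint ipF ipF C (C (V t x)))
        - hm_adjoint ipE ipF (V s) (hm_adjoint ipF ipF C (C (V s x)))
        - hm_adjoint ipE ipF (V t) (hm_adjoint ipF ipF C (C (V t x)))))"
proof -
  interpret E: hilbert_module actE ipE by fact
  let ?L = "kolm_L K s0" and ?L' = "kolm_L K' s0"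
  have herm: "hermitian_kernel ipE K" "hermitian_kernel ipE K'"
    using assms(2,3) by (auto simp: cond_pos_def_kernel_def)
  obtain \<iota> where \<iota>: "kolm_completion actE ipE ?L actF ipF \<iota>"
    "\<And>s x. V s x = \<iota> (kolm_hat ?L (point_map s x))"
    using assms(8) by (auto simp: min_kolmogorov_def)
  obtain \<iota>' where \<iota>': "kolm_completion actE ipE ?L' actF' ipF' \<iota>'"
    using assms(10) by (auto simp: min_kolmogorov_def)
  have ks: "kolmogorov_space actE ipE actF ipF ?L \<iota>"
    using assms(1) \<iota>(1) E.kolm_L_adjoint[OF herm(1)]
    by (simp add: kolmogorov_space_def kolmogorov_space_axioms_def kolm_completion_def Let_def)
  have ks': "kolmogorov_space actE ipE actF' ipF' ?L' \<iota>'"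
    using assms(1) \<iota>' E.kolm_L_adjoint[OF herm(2)]
    by (simp add: kolmogorov_space_def kolmogorov_space_axioms_def kolm_completion_def Let_def)
  interpret KF: kolmogorov_space actE ipE actF ipF ?L \<iota> by (rule ks)
  have V: "V = KF.V" by (intro ext) (simp add: \<iota>(2) KF.V_def KF.I_def)
  note K_L = E.kernel_via_kolm_L[OF herm(1) assms(4,6)]
    and K'_L = E.kernel_via_kolm_L[OF herm(2) assms(5,7)]
  show ?thesis
  proof
    assume le: "kernel_le ipE K' K"
    have "positive_elem (ipF (kolmogorov_space.I ?L \<iota> f) (kolmogorov_space.I ?L \<iota> f)
        - ipF' (kolmogorov_space.I ?L' \<iota>' f) (kolmogorov_space.I ?L' \<iota>' f))" if "f \<in> fin_supp" for f
      by (rule kolm_forms_dominated[OF ks ks' K_L K'_L _ _ _ _ le that, of s0]) (simp_all add: kolm_L_def)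
    then obtain C where C: "C \<in> adjointables ipF ipF" "positive_op ipF C" "hm_op_norm ipF ipF C \<le> 1"
      "\<And>s t x. hm_adjoint ipE ipF (KF.V s) (hm_adjoint ipF ipF C (C (KF.V t x))) = ?L' s t x"
      by (rule contraction_if_dominated[OF ks ks' assms(9)]) (assumption, rule that)
    show "\<exists>C \<in> adjointables ipF ipF. positive_op ipF C \<and> hm_op_norm ipF ipF C \<le> 1 \<and>
      (\<forall>s t x. K' s t x =
        2 *\<^sub>R hm_adjoint ipE ipF (V s) (hm_adjoint ipF ipF C (C (V t x)))
        - hm_adjoint ipE ipF (V s) (hm_adjoint ipF ipF C (C (V s x)))
        - hm_adjoint ipE ipF (V t) (hm_adjoint ipF ipF C (C (V t x))))"
    proof (intro bexI[of _ C] conjI allI C(1-3))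
      fix s t x
      show "K' s t x =
        2 *\<^sub>R hm_adjoint ipE ipF (V s) (hm_adjoint ipF ipF C (C (V t x)))
        - hm_adjoint ipE ipF (V s) (hm_adjoint ipF ipF C (C (V s x)))
        - hm_adjoint ipE ipF (V t) (hm_adjoint ipF ipF C (C (V t x)))"
        \<comment> \<open>After compression to \<open>L'\<close> the formula is the recovery of K'
          from its own \<open>L'\<close>.\<close>
        unfolding V C(4) by (rule K'_L)
    qed
  next
    assume "\<exists>C \<in> adjointables ipF ipF. positive_op ipF C \<and> hm_op_norm ipF ipF C \<le> 1 \<and>
      (\<forall>s t x. K' s t x =
        2 *\<^sub>R hm_adjoint ipE ipF (V s) (hm_adjoint ipF ipF C (C (V t x)))
        - hm_adjoint ipE ipF (V s) (hm_adjoint ipF ipF C (C (V s x)))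
        - hm_adjoint ipE ipF (V t) (hm_adjoint ipF ipF C (C (V t x))))"
    then obtain C where C: "C \<in> adjointables ipF ipF" "hm_op_norm ipF ipF C \<le> 1"
      "\<forall>s t x. K' s t x =
        2 *\<^sub>R hm_adjoint ipE ipF (V s) (hm_adjoint ipF ipF C (C (V t x)))
        - hm_adjoint ipE ipF (V s) (hm_adjoint ipF ipF C (C (V s x)))
        - hm_adjoint ipE ipF (V t) (hm_adjoint ipF ipF C (C (V t x)))"
      by (elim bexE conjE) (rule that)
    show "kernel_le ipE K' K"
      by (rule KF.kernel_le_if_contraction[OF herm(1) K_L herm(2) C(1,2)]) (rule C(3)[unfolded V, rule_format])
  qed
qed

end
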